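(* Let $\Omega$ be a Polish space and let $\mathcal{L}\subset\mathcal{C}_b(\Omega)$ be a linear subspace which is a vector lattice, contains the constants and generates the topology of $\Omega$. Let $\rho$ be a normalized uniformly regular convex risk measure on $\mathcal{L}$. Then $\rho$ extends uniquely to $\mathcal{C}_b(\Omega)$ (as a continuous map for the capacity $c_\rho$ defined below) and there is a weakly relatively compact countable set $\{Q_n,\ n\in\mathbb{N}\}$ of Borel probability measures on $\Omega$ such that $$\forall X\in\mathcal{C}_b(\Omega),\quad \rho(X)=\sup_{n\in\mathbb{N}}\big(E_{Q_n}(-X)-\alpha(Q_n)\big),$$ where $\alpha(Q)=\sup_{Y\in \mathcal{C}_b(\Omega)}\big(E_Q(-Y)-\rho(Y)\big)$. Furthermore, for any $\alpha_n>0$ with $\sum_{n}\alpha_n=1$, the probability measure $P=\sum_n\alpha_nQ_n$ characterizes the riskless non-positive elements of $\mathcal{C}_b(\Omega)$: an element $X\le 0$ of $\mathcal{C}_b(\Omega)$ is riskless if and only if $X=0$ $P$-a.s. Finally, for every $X\in\mathcal{C}_b(\Omega)$ there is a probability measure $Q_X$ in the weak closure of $\{Q_n,\ n\in\mathbb{N}\}$ such that $\rho(X)=E_{Q_X}(-X)-\alpha(Q_X)$.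
   Context: A map $\rho:\mathcal{L}\to\mathbb{R}$ is a convex risk measure if it is monotone ($X\le Y\Rightarrow \rho(X)\ge\rho(Y)$), convex, and translation invariant ($\rho(X+a)=\rho(X)-a$ for $a\in\mathbb{R}$); it is normalized if $\rho(0)=0$; it is sublinear if moreover positively homogeneous. A normalized convex risk measure $\rho$ on $\mathcal{L}$ is uniformly regular if for every $X\in\mathcal{L}$, $\sup_{\lambda>0}\rho(\lambda X)/\lambda<\infty$, and for every sequence $X_n\in\mathcal{L}$ decreasing pointwise to $0$, $\rho(-\lambda X_n)/\lambda\to 0$ uniformly in $\lambda>0$. The capacity canonically associated with $\rho$ is $c_\rho(X)=\rho_{\min}(-|X|)$ where $\rho_{\min}(X)=\sup_{\lambda>0}\rho(\lambda X)/\lambda$. A non-positive element $X$ of $\mathcal{C}_b(\Omega)$ is riskless if $\rho(\lambda X)=0$ for all $\lambda>0$ (where $\rho$ denotes the extension to $\mathcal{C}_b(\Omega)$). *)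

theory Defs
  imports "HOL-Probability.Probability"
begin

definition Cb :: "('a::topological_space \<Rightarrow> real) set" where
  "Cb = {f. continuous_on UNIV f \<and> bounded (range f)}"

definition admissible_space :: "('a::topological_space \<Rightarrow> real) set \<Rightarrow> bool" where
  "admissible_space L \<longleftrightarrow>
     L \<subseteq> Cb \<and>
     (\<forall>X\<in>L. \<forall>Y\<in>L. (\<lambda>\<omega>. X \<omega> + Y \<omega>) \<in> L) \<and>
     (\<forall>X\<in>L. \<forall>c::real. (\<lambda>\<omega>. c * X \<omega>) \<in> L) \<and>
     (\<forall>X\<in>L. \<forall>Y\<in>L. (\<lambda>\<omega>. max (X \<omega>) (Y \<omega>)) \<in> L) \<and>
     (\<forall>c::real. (\<lambda>_. c) \<in> L) \<and>
     (\<forall>S. open S \<longleftrightarrow> generate_topology {f -` U | f U. f \<in> L \<and> open U} S)"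

definition convex_risk_measure :: "('a \<Rightarrow> real) set \<Rightarrow> (('a \<Rightarrow> real) \<Rightarrow> real) \<Rightarrow> bool" where
  "convex_risk_measure L \<rho> \<longleftrightarrow>
     (\<forall>X\<in>L. \<forall>Y\<in>L. (\<forall>\<omega>. X \<omega> \<le> Y \<omega>) \<longrightarrow> \<rho> X \<ge> \<rho> Y) \<and>
     (\<forall>X\<in>L. \<forall>Y\<in>L. \<forall>t::real. 0 \<le> t \<and> t \<le> 1 \<longrightarrow>
        \<rho> (\<lambda>\<omega>. t * X \<omega> + (1 - t) * Y \<omega>) \<le> t * \<rho> X + (1 - t) * \<rho> Y) \<and>
     (\<forall>X\<in>L. \<forall>a::real. \<rho> (\<lambda>\<omega>. X \<omega> + a) = \<rho> X - a)"

definition normalized :: "(('a \<Rightarrow> real) \<Rightarrow> real) \<Rightarrow> bool" where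
  "normalized \<rho> \<longleftrightarrow> \<rho> (\<lambda>_. 0) = 0"

definition uniformly_regular :: "('a \<Rightarrow> real) set \<Rightarrow> (('a \<Rightarrow> real) \<Rightarrow> real) \<Rightarrow> bool" where
  "uniformly_regular L \<rho> \<longleftrightarrow>
     (\<forall>X\<in>L. bdd_above {\<rho> (\<lambda>\<omega>. l * X \<omega>) / l | l::real. l > 0}) \<and>
     (\<forall>Xs. (\<forall>n. Xs n \<in> L) \<and> (\<forall>\<omega>. decseq (\<lambda>n. Xs n \<omega>) \<and> (\<lambda>n. Xs n \<omega>) \<longlonglongrightarrow> 0) \<longrightarrow>
        (\<forall>e>0. \<exists>N. \<forall>n\<ge>N. \<forall>l::real>0. \<bar>\<rho> (\<lambda>\<omega>. - l * Xs n \<omega>) / l\<bar> < e))"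

definition rho_min :: "(('a \<Rightarrow> real) \<Rightarrow> real) \<Rightarrow> ('a \<Rightarrow> real) \<Rightarrow> real" where
  "rho_min \<rho> X = Sup {\<rho> (\<lambda>\<omega>. l * X \<omega>) / l | l::real. l > 0}"

definition c_rho :: "(('a \<Rightarrow> real) \<Rightarrow> real) \<Rightarrow> ('a \<Rightarrow> real) \<Rightarrow> real" where
  "c_rho \<rho> X = rho_min \<rho> (\<lambda>\<omega>. - \<bar>X \<omega>\<bar>)"

text \<open>Extension of the capacity c_\<rho> to arbitrary functions (upper capacity):
  c(X) = inf { c_\<rho>(Y) : Y \<in> L, Y \<ge> |X| }.\<close>
definition cap :: "('a \<Rightarrow> real) set \<Rightarrow> (('a \<Rightarrow> real) \<Rightarrow> real) \<Rightarrow> ('a \<Rightarrow> real) \<Rightarrow> real" where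
  "cap L \<rho> X = Inf {c_rho \<rho> Y | Y. Y \<in> L \<and> (\<forall>\<omega>. \<bar>X \<omega>\<bar> \<le> Y \<omega>)}"

definition cap_continuous_extension ::
  "('a::topological_space \<Rightarrow> real) set \<Rightarrow> (('a \<Rightarrow> real) \<Rightarrow> real) \<Rightarrow> (('a \<Rightarrow> real) \<Rightarrow> real) \<Rightarrow> bool" where
  "cap_continuous_extension L \<rho> \<rho>' \<longleftrightarrow>
     (\<forall>X\<in>L. \<rho>' X = \<rho> X) \<and>
     (\<forall>X\<in>Cb. \<forall>Xs. (\<forall>n. Xs n \<in> Cb) \<and> (\<lambda>n. cap L \<rho> (\<lambda>\<omega>. Xs n \<omega> - X \<omega>)) \<longlonglongrightarrow> 0
        \<longrightarrow> (\<lambda>n. \<rho>' (Xs n)) \<longlonglongrightarrow> \<rho>' X)"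

definition borel_probs :: "'a::topological_space measure set" where
  "borel_probs = {M. sets M = sets borel \<and> prob_space M}"

definition weak_top :: "'a::topological_space measure topology" where
  "weak_top = subtopology
     (topology_generated_by {{M \<in> borel_probs. (\<integral>\<omega>. f \<omega> \<partial>M) \<in> U} | f U. f \<in> Cb \<and> open U})
     borel_probs"

definition penalty :: "(('a::topological_space \<Rightarrow> real) \<Rightarrow> real) \<Rightarrow> 'a measure \<Rightarrow> ereal" where
  "penalty \<rho> Q = (SUP Y\<in>Cb. ereal ((\<integral>\<omega>. - Y \<omega> \<partial>Q) - \<rho> Y))"

definition riskless :: "(('a \<Rightarrow> real) \<Rightarrow> real) \<Rightarrow> ('a \<Rightarrow> real) \<Rightarrow> bool" where
  "riskless \<rho> X \<longleftrightarrow> (\<forall>l::real>0. \<rho> (\<lambda>\<omega>. l * X \<omega>) = 0)"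

end

theory Submission
  imports Defs
begin

text \<open>Since the lattice \<open>L\<close> contains the constants and generates the topology, the Lindeloef
  property yields, for every bounded continuous \<open>X\<close>, sequences \<open>Z\<^sub>n\<close> increasing and \<open>Y\<^sub>n\<close> decreasing
  to \<open>X\<close> in \<open>L\<close>. Uniform regularity makes the capacity of \<open>Y\<^sub>n - Z\<^sub>n\<close> vanish, and convexity gives
  \<open>\<rho> X - \<rho> Y \<le> rho_min (X - Y)\<close>; hence \<open>\<rho>\<close> has exactly one capacity-continuous extension, and this
  extension is again a uniformly regular risk measure. On bounded continuous functions every linear
  functional dominated by \<open>rho_min\<close> satisfies Daniell's condition, so it is integration against a
  probability measure, and these measures form a weakly compact set by Tychonoff's theorem. A
  subgradient of \<open>\<rho>\<close> at \<open>X\<close> is a measure of this kind that attains the dual representation at \<open>X\<close>.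
  Choosing one for each element of a countable family that approximates all functions from above
  yields the sequence \<open>Q\<^sub>n\<close>; attainment in its closure follows from compactness, and finiteness of the
  penalties gives the description of riskless elements.\<close>

section \<open>Subgradients of convex functions\<close>

text \<open>Two obstacles shape the proof. As \<Omega> need not be compact, a subgradient of \<rho>
  on \<open>Cb\<close> could be merely finitely additive. It always lies below
  \<open>rho_min\<close>, the least positively homogeneous majorant of \<rho>, and uniformity in the
  scaling parameter is what hands continuity along decreasing sequences on from \<rho> to
  \<open>rho_min\<close>, hence to every functional below it. One bound thus gives countable
  additivity and compactness together. Secondly, \<open>Cb\<close> is in general not separable in
  the supremum norm, so countably many measures cannot come from a dense set of functions; pointwise
  approximation from one side has to do, and the side is dictated by the antitonicity of \<rho> and
  of E_Q(-X). The extension precedes all duality because cones built from the metric lie in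
  \<open>Cb\<close> but perhaps not in \<open>L\<close>. The basic estimates are proved for any
  function lattice, to be used on \<open>L\<close> before the extension and on \<open>Cb\<close>
  after it.\<close>

lemma cInf_le_add:
  fixes S T U :: "real set"
  assumes "bdd_below S" "T \<noteq> {}" "U \<noteq> {}"
    and le: "\<And>t u. t \<in> T \<Longrightarrow> u \<in> U \<Longrightarrow> \<exists>s\<in>S. s \<le> t + u"
  shows "Inf S \<le> Inf T + Inf U"
proof -
  have *: "Inf S \<le> t + u" if "t \<in> T" "u \<in> U" for t u
    using le[OF that] assms(1) by (meson cInf_lower2)
  have "Inf S - u \<le> Inf T" if "u \<in> U" for u
    using * that \<open>T \<noteq> {}\<close> by (intro cInf_greatest) (auto simp: algebra_simps)
  then have "Inf S - Inf T \<le> Inf U"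
    using \<open>U \<noteq> {}\<close> by (intro cInf_greatest) (auto simp: algebra_simps)
  then show ?thesis by simp
qed

text \<open>With \<open>cInf_le_add\<close>, this reduces sublinearity of a pointwise infimum to one
  choice of an element per inequality; three such infima follow.\<close>

lemma cInf_le_scale:
  fixes S T :: "real set"
  assumes "bdd_below S" "T \<noteq> {}" "c > 0" and le: "\<And>t. t \<in> T \<Longrightarrow> \<exists>s\<in>S. s \<le> c * t"
  shows "Inf S \<le> c * Inf T"
proof -
  have "Inf S \<le> c * t" if "t \<in> T" for t
    using le[OF that] assms(1) by (meson cInf_lower2)
  then have "Inf S / c \<le> Inf T"
    using assms by (intro cInf_greatest) (auto simp: divide_le_eq mult.commute)
  then show ?thesis using \<open>c > 0\<close> by (simp add: divide_le_eq mult.commute)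
qed

text \<open>Homogeneity is asked only as an inequality for positive factors, which shortens the
  verification for each infimum below; using it for \<open>c\<close> and \<open>1/c\<close> gives
  equality.\<close>

definition sublinear :: "('v::real_vector \<Rightarrow> real) \<Rightarrow> bool" where
  "sublinear p \<longleftrightarrow> (\<forall>x y. p (x + y) \<le> p x + p y) \<and> (\<forall>x. \<forall>c>0. p (c *\<^sub>R x) \<le> c * p x)"

lemma sublinear_add: "sublinear p \<Longrightarrow> p (x + y) \<le> p x + p y"
  by (simp add: sublinear_def)

lemma sublinear_zero:
  assumes "sublinear p" shows "p 0 = 0"
proof -
  have "p ((1/2) *\<^sub>R 0) \<le> (1/2) * p 0" "p (0 + 0) \<le> p 0 + p 0"
    using assms unfolding sublinear_def by (meson half_gt_zero zero_less_one)+
  then show ?thesis by simp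
qed

lemma sublinear_scale:
  assumes "sublinear p" "c \<ge> 0" shows "p (c *\<^sub>R x) = c * p x"
proof (cases "c = 0")
  case True then show ?thesis using sublinear_zero[OF assms(1)] by simp
next
  case False
  then have c: "c > 0" using assms by simp
  have "p ((1/c) *\<^sub>R (c *\<^sub>R x)) \<le> (1/c) * p (c *\<^sub>R x)" "p (c *\<^sub>R x) \<le> c * p x"
    using assms(1) c unfolding sublinear_def by (meson zero_less_divide_1_iff)+
  then show ?thesis using c by (simp add: field_simps)
qed

lemma sublinear_minus: "sublinear p \<Longrightarrow> - p (- x) \<le> p x"
  using sublinear_add[of p x "- x"] sublinear_zero[of p] by simp

text \<open>The competitor is r x = inf over t \<ge> 0 of q (x + t y) - t q y, which is sublinear
  and at most q, hence equal to q. At -y the choice t = 1 gives q (-y) \<le> - q y, so q is odd, and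
  an odd sublinear function is additive.\<close>

lemma minimal_sublinear_imp_linear:
  fixes q :: "'v::real_vector \<Rightarrow> real"
  assumes q: "sublinear q"
    and min: "\<And>r. sublinear r \<Longrightarrow> (\<And>x. r x \<le> q x) \<Longrightarrow> r = q"
  shows "linear q"
proof -
  have odd: "q (- y) = - q y" for y
  proof -
    define A where "A x = (\<lambda>t. q (x + t *\<^sub>R y) - t * q y) ` {0..}" for x
    define r where "r x = Inf (A x)" for x
    have "- q (- x) \<le> q (x + t *\<^sub>R y) - t * q y" if "t \<ge> 0" for x t
      using sublinear_add[OF q, of "x + t *\<^sub>R y" "- x"] sublinear_scale[OF q that, of y] by simp
    then have bdd: "bdd_below (A x)" for x
      unfolding A_def by (intro bdd_belowI2[where m="- q (- x)"]) simp
    have ne: "A x \<noteq> {}" for x unfolding A_def by auto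
    have "r (x + x') \<le> r x + r x'" for x x'
      unfolding r_def
    proof (rule cInf_le_add[OF bdd ne ne])
      fix a b assume "a \<in> A x" "b \<in> A x'"
      then obtain s t where st: "s \<ge> 0" "t \<ge> 0" "a = q (x + s *\<^sub>R y) - s * q y"
        "b = q (x' + t *\<^sub>R y) - t * q y" by (auto simp: A_def)
      have "q (x + x' + (s + t) *\<^sub>R y) - (s + t) * q y \<le> a + b"
        using sublinear_add[OF q, of "x + s *\<^sub>R y" "x' + t *\<^sub>R y"] st
        by (simp add: algebra_simps)
      then show "\<exists>s\<in>A (x + x'). s \<le> a + b"
        unfolding A_def using st by (intro bexI) (auto intro: image_eqI[where x="s+t"])
    qed
    moreover have "r (c *\<^sub>R x) \<le> c * r x" if "c > 0" for c x
      unfolding r_def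
    proof (rule cInf_le_scale[OF bdd ne that])
      fix a assume "a \<in> A x"
      then obtain s where s: "s \<ge> 0" "a = q (x + s *\<^sub>R y) - s * q y" by (auto simp: A_def)
      have "q (c *\<^sub>R x + (c * s) *\<^sub>R y) - (c * s) * q y = c * a"
        using sublinear_scale[OF q, of c "x + s *\<^sub>R y"] s(2) that
        by (simp add: scaleR_add_right right_diff_distrib)
      then show "\<exists>b\<in>A (c *\<^sub>R x). b \<le> c * a"
        unfolding A_def using s that by (intro bexI) (auto intro!: image_eqI[where x="c * s"])
    qed
    ultimately have "sublinear r" by (simp add: sublinear_def)
    moreover have "r x \<le> q x" for x
      unfolding r_def
      by (intro cInf_lower2[OF _ _ bdd, of "q x"]) (auto simp: A_def intro!: image_eqI[where x=0])
    ultimately have "r = q" by (rule min)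
    moreover have "r (- y) \<le> - q y"
      unfolding r_def
      by (intro cInf_lower bdd) (auto simp: A_def sublinear_zero[OF q] intro!: image_eqI[where x=1])
    ultimately have "q (- y) \<le> - q y" by simp
    then show ?thesis using sublinear_minus[OF q, of y] by linarith
  qed
  have add: "q (x + y) = q x + q y" for x y
    using sublinear_add[OF q, of x y] sublinear_add[OF q, of "- x" "- y"] odd[of "x + y"] odd
    by (simp add: algebra_simps)
  have "q (c *\<^sub>R x) = c * q x" for c x
  proof (cases "c \<ge> 0")
    case True then show ?thesis by (rule sublinear_scale[OF q])
  next
    case False
    then show ?thesis using sublinear_scale[OF q, of "- c" x] odd[of "c *\<^sub>R x"] by simp
  qed
  with add show ?thesis by (intro linearI) auto
qed

text \<open>Zorn's lemma is applied with the order reversed by \<open>ge\<close>, so that a maximal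
  element is a minimal sublinear function below \<open>p\<close>, and such a function is
  linear.\<close>

lemma hahn_banach_sublinear:
  fixes p :: "'v::real_vector \<Rightarrow> real"
  assumes p: "sublinear p"
  obtains l where "linear l" "\<And>x. l x \<le> p x"
proof -
  define A where "A = {q. sublinear q \<and> (\<forall>x. q x \<le> p x)}"
  define ge :: "('v \<Rightarrow> real) \<Rightarrow> ('v \<Rightarrow> real) \<Rightarrow> bool" where "ge f g \<longleftrightarrow> (\<forall>x. g x \<le> f x)" for f g
  have "\<exists>m\<in>A. \<forall>a\<in>A. ge m a \<longrightarrow> a = m"
  proof (rule predicate_Zorn)
    show "partial_order_on A (relation_of ge A)"
      by (rule partial_order_on_relation_ofI) (auto simp: ge_def fun_eq_iff intro: order_trans antisym)
  next
    fix C assume "C \<in> Chains (relation_of ge A)"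
    then have CA: "C \<subseteq> A" and chain: "\<And>f g. f \<in> C \<Longrightarrow> g \<in> C \<Longrightarrow> ge f g \<or> ge g f"
      by (auto simp: Chains_def relation_of_def)
    show "\<exists>u\<in>A. \<forall>a\<in>C. ge a u"
    proof (cases "C = {}")
      case True then show ?thesis using p by (auto simp: A_def)
    next
      case False
      define B where "B x = (\<lambda>q. q x) ` C" for x
      define u where "u x = Inf (B x)" for x
      have ne: "B x \<noteq> {}" for x using False by (simp add: B_def)
      have sub: "sublinear q" and qp: "q x \<le> p x" if "q \<in> C" for q x
        using that CA by (auto simp: A_def)
      have "- p (- x) \<le> q x" if "q \<in> C" for q x
        using sublinear_minus[OF sub[OF that], of x] qp[OF that, of "- x"] by linarith
      then have bdd: "bdd_below (B x)" for x
        unfolding B_def by (intro bdd_belowI2[where m="- p (- x)"]) simp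
      have "u (x + y) \<le> u x + u y" for x y
        unfolding u_def
      proof (rule cInf_le_add[OF bdd ne ne])
        fix s t assume "s \<in> B x" "t \<in> B y"
        then obtain f g where fg: "f \<in> C" "g \<in> C" "s = f x" "t = g y" by (auto simp: B_def)
        \<comment> \<open>An infimum of sublinear functions need not be subadditive. In a chain, the
          smaller of \<open>f\<close> and \<open>g\<close> serves both points at once.\<close>
        define h where "h = (if ge f g then g else f)"
        have "h \<in> C" "h x \<le> f x" "h y \<le> g y"
          using fg chain[of f g] by (auto simp: h_def ge_def split: if_splits)
        then have "h (x + y) \<in> B (x + y)" "h (x + y) \<le> s + t"
          using sublinear_add[OF sub, of h x y] fg by (auto simp: B_def)
        then show "\<exists>r\<in>B (x + y). r \<le> s + t" by blast
      qed
      moreover have "u (c *\<^sub>R x) \<le> c * u x" if "c > 0" for c x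
        unfolding u_def
      proof (rule cInf_le_scale[OF bdd ne that])
        fix t assume "t \<in> B x"
        then obtain q where "q \<in> C" "t = q x" by (auto simp: B_def)
        then show "\<exists>s\<in>B (c *\<^sub>R x). s \<le> c * t"
          using sublinear_scale[OF sub, of q c x] that unfolding B_def by (metis image_eqI less_imp_le order_refl)
      qed
      moreover have le: "u x \<le> q x" if "q \<in> C" for q x
        unfolding u_def using that by (intro cInf_lower bdd) (auto simp: B_def)
      moreover have "u x \<le> p x" for x
        using False le qp by (meson all_not_in_conv order_trans)
      ultimately show ?thesis by (intro bexI[of _ u]) (auto simp: A_def sublinear_def ge_def)
    qed
  qed
  then obtain q where "q \<in> A" and min: "\<And>r. r \<in> A \<Longrightarrow> ge q r \<Longrightarrow> r = q" by blast
  then have q: "sublinear q" "\<And>x. q x \<le> p x" by (auto simp: A_def)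
  have "linear q"
  proof (rule minimal_sublinear_imp_linear[OF q(1)])
    fix r assume "sublinear r" "\<And>x. r x \<le> q x"
    then show "r = q" using q(2) by (intro min) (auto simp: A_def ge_def intro: order_trans)
  qed
  with q that show ?thesis by blast
qed

text \<open>The Hahn-Banach theorem is applied to the directional derivative of \<open>f\<close> at \<open>x0\<close>, written as
  an infimum of difference quotients so that no limit is needed.\<close>

lemma convex_on_subgradient:
  fixes f :: "'v::real_vector \<Rightarrow> real"
  assumes f: "convex_on UNIV f"
  obtains l where "linear l" "\<And>y. f x0 + l y \<le> f (x0 + y)"
proof -
  define A where "A y = (\<lambda>t. (f (x0 + t *\<^sub>R y) - f x0) / t) ` {0<..}" for y
  define p where "p y = Inf (A y)" for y
  have cv: "f (u *\<^sub>R x + v *\<^sub>R y) \<le> u * f x + v * f y" if "u \<ge> 0" "v \<ge> 0" "u + v = 1" for u v x y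
    using f that unfolding convex_on_def by auto
  \<comment> \<open>x0 is the mixture of x0 + t y and x0 - y with weights 1/(1+t) and t/(1+t); this
    bounds the quotients from below independently of t.\<close>
  have "f x0 - f (x0 - y) \<le> (f (x0 + t *\<^sub>R y) - f x0) / t" if t: "t > 0" for t y
  proof -
    have "(1/(1+t)) *\<^sub>R (x0 + t *\<^sub>R y) + (t/(1+t)) *\<^sub>R (x0 - y) = (1/(1+t) + t/(1+t)) *\<^sub>R x0"
      by (simp add: algebra_simps)
    also have "1/(1+t) + t/(1+t) = 1" using t by (simp add: field_simps)
    finally have "f x0 \<le> (1/(1+t)) * f (x0 + t *\<^sub>R y) + (t/(1+t)) * f (x0 - y)"
      using cv[of "1/(1+t)" "t/(1+t)" "x0 + t *\<^sub>R y" "x0 - y"] t by (simp add: field_simps)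
    also have "\<dots> = (f (x0 + t *\<^sub>R y) + t * f (x0 - y)) / (1+t)" by (simp add: add_divide_distrib)
    finally have "f x0 * (1 + t) \<le> f (x0 + t *\<^sub>R y) + t * f (x0 - y)"
      using t by (simp add: pos_le_divide_eq)
    then have "(f x0 - f (x0 - y)) * t \<le> f (x0 + t *\<^sub>R y) - f x0" by (simp add: algebra_simps)
    then show ?thesis using t by (simp add: pos_le_divide_eq)
  qed
  then have bdd: "bdd_below (A y)" for y
    unfolding A_def by (intro bdd_belowI2[where m="f x0 - f (x0 - y)"]) simp
  have ne: "A y \<noteq> {}" for y unfolding A_def by simp
  have "p (y + z) \<le> p y + p z" for y z
    unfolding p_def
  proof (rule cInf_le_add[OF bdd ne ne])
    fix a b assume "a \<in> A y" "b \<in> A z"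
    then obtain s t where st: "s > 0" "t > 0" and ab: "a = (f (x0 + s *\<^sub>R y) - f x0) / s"
      "b = (f (x0 + t *\<^sub>R z) - f x0) / t" by (auto simp: A_def)
    \<comment> \<open>The weights satisfy u s = v t = r, so that mixing x0 + s y and x0 + t z
      produces the same step r in both directions.\<close>
    define r where "r = s * t / (s + t)"
    define u v where "u = t / (s + t)" and "v = s / (s + t)"
    have r: "r > 0" "u \<ge> 0" "v \<ge> 0" "u * s = r" "v * t = r"
      using st by (auto simp: r_def u_def v_def)
    have uv: "u + v = 1" using st by (simp add: u_def v_def add_divide_distrib[symmetric] add.commute)
    have "u *\<^sub>R (x0 + s *\<^sub>R y) + v *\<^sub>R (x0 + t *\<^sub>R z) = (u + v) *\<^sub>R x0 + (u * s) *\<^sub>R y + (v * t) *\<^sub>R z"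
      by (simp add: algebra_simps)
    then have "u *\<^sub>R (x0 + s *\<^sub>R y) + v *\<^sub>R (x0 + t *\<^sub>R z) = x0 + r *\<^sub>R (y + z)"
      using r uv by (simp add: algebra_simps)
    then have "f (x0 + r *\<^sub>R (y + z)) \<le> u * f (x0 + s *\<^sub>R y) + v * f (x0 + t *\<^sub>R z)"
      using cv[OF r(2,3) uv] by metis
    moreover have "f x0 = u * f x0 + v * f x0" using uv by (metis distrib_right mult_1)
    moreover have "f (x0 + s *\<^sub>R y) = f x0 + s * a" "f (x0 + t *\<^sub>R z) = f x0 + t * b"
      using st ab by auto
    ultimately have "f (x0 + r *\<^sub>R (y + z)) - f x0 \<le> (u * s) * a + (v * t) * b"
      by (simp add: algebra_simps)
    then have "(f (x0 + r *\<^sub>R (y + z)) - f x0) / r \<le> a + b"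
      using r by (simp add: pos_divide_le_eq algebra_simps)
    then show "\<exists>c\<in>A (y + z). c \<le> a + b" using r by (auto simp: A_def)
  qed
  moreover have "p (c *\<^sub>R y) \<le> c * p y" if c: "c > 0" for c y
    unfolding p_def
  proof (rule cInf_le_scale[OF bdd ne c])
    fix a assume "a \<in> A y"
    then obtain t where t: "t > 0" "a = (f (x0 + t *\<^sub>R y) - f x0) / t" by (auto simp: A_def)
    then have "(f (x0 + (t/c) *\<^sub>R (c *\<^sub>R y)) - f x0) / (t/c) = c * a" "t/c > 0"
      using c by auto
    then show "\<exists>b\<in>A (c *\<^sub>R y). b \<le> c * a" unfolding A_def
      by (intro bexI[OF _ image_eqI[where x="t/c"]]) auto
  qed
  ultimately have "sublinear p" by (simp add: sublinear_def)
  then obtain l where l: "linear l" "\<And>y. l y \<le> p y" by (rule hahn_banach_sublinear) blast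
  have "p y \<le> f (x0 + y) - f x0" for y
    unfolding p_def by (intro cInf_lower bdd) (auto simp: A_def intro!: image_eqI[where x=1])
  then have le: "l y \<le> f (x0 + y) - f x0" for y using l(2) by (rule order_trans[rotated])
  have "f x0 + l y \<le> f (x0 + y)" for y using le[of y] by linarith
  with l that show ?thesis by blast
qed

section \<open>Daniell functionals\<close>

lemma CbI: "continuous_on UNIV f \<Longrightarrow> (\<And>w. \<bar>f w\<bar> \<le> B) \<Longrightarrow> f \<in> Cb"
  unfolding Cb_def by (auto simp: bounded_iff)

lemma Cb_continuous: "f \<in> Cb \<Longrightarrow> continuous_on UNIV f"
  by (simp add: Cb_def)

lemma Cb_bound:
  assumes "f \<in> Cb" obtains B where "B > 0" "\<And>w. \<bar>f w\<bar> \<le> B"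
  using assms unfolding Cb_def by (auto simp: bounded_pos)

lemma Cb_const [simp, intro]: "(\<lambda>_. c) \<in> Cb"
  by (rule CbI[where B="\<bar>c\<bar>"]) auto

lemma Cb_add [intro]:
  assumes "f \<in> Cb" "g \<in> Cb" shows "(\<lambda>w. f w + g w) \<in> Cb"
proof -
  obtain B C where "\<And>w. \<bar>f w\<bar> \<le> B" "\<And>w. \<bar>g w\<bar> \<le> C" using assms by (metis Cb_bound)
  then have "\<bar>f w + g w\<bar> \<le> B + C" for w by (meson abs_triangle_ineq add_mono order_trans)
  then show ?thesis using assms[THEN Cb_continuous] by (intro CbI continuous_intros)
qed

lemma Cb_scale [intro]:
  assumes "f \<in> Cb" shows "(\<lambda>w. c * f w) \<in> Cb"
proof -
  obtain B where "\<And>w. \<bar>f w\<bar> \<le> B" using assms by (metis Cb_bound)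
  then have "\<bar>c * f w\<bar> \<le> \<bar>c\<bar> * B" for w by (simp add: abs_mult mult_left_mono)
  then show ?thesis using assms[THEN Cb_continuous] by (intro CbI continuous_intros)
qed

lemma Cb_minus [intro]: "f \<in> Cb \<Longrightarrow> (\<lambda>w. - f w) \<in> Cb"
  using Cb_scale[of f "-1"] by simp

lemma Cb_diff [intro]: "f \<in> Cb \<Longrightarrow> g \<in> Cb \<Longrightarrow> (\<lambda>w. f w - g w) \<in> Cb"
  using Cb_add[of f "\<lambda>w. - g w"] by auto

lemma Cb_max [intro]:
  assumes "f \<in> Cb" "g \<in> Cb" shows "(\<lambda>w. max (f w) (g w)) \<in> Cb"
proof -
  obtain B C where "\<And>w. \<bar>f w\<bar> \<le> B" "\<And>w. \<bar>g w\<bar> \<le> C" using assms by (metis Cb_bound)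
  then have "\<bar>max (f w) (g w)\<bar> \<le> max B C" for w
    by (smt (verit))
  then show ?thesis using assms[THEN Cb_continuous] by (intro CbI continuous_intros)
qed

lemma Cb_min [intro]:
  assumes "f \<in> Cb" "g \<in> Cb" shows "(\<lambda>w. min (f w) (g w)) \<in> Cb"
proof -
  have "(\<lambda>w. min (f w) (g w)) = (\<lambda>w. - max (- f w) (- g w))" by (auto simp: fun_eq_iff)
  then show ?thesis using Cb_minus[OF Cb_max[OF Cb_minus[OF assms(1)] Cb_minus[OF assms(2)]]] by simp
qed

lemma Cb_sum [intro]:
  assumes "\<And>i. i \<in> I \<Longrightarrow> f i \<in> Cb" shows "(\<lambda>w. \<Sum>i\<in>I. f i w) \<in> Cb"
  using assms by (induction I rule: infinite_finite_induct) auto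

lemma Cb_borel_measurable: "f \<in> Cb \<Longrightarrow> f \<in> borel_measurable borel"
  by (intro borel_measurable_continuous_onI Cb_continuous)

lemma Cb_integrable:
  assumes "M \<in> borel_probs" "f \<in> Cb" shows "integrable M f"
proof -
  interpret prob_space M using assms by (simp add: borel_probs_def)
  obtain B where "\<And>w. \<bar>f w\<bar> \<le> B" using assms by (metis Cb_bound)
  moreover have "f \<in> borel_measurable M"
    using assms Cb_borel_measurable by (auto simp: borel_probs_def cong: measurable_cong_sets)
  ultimately show ?thesis by (intro integrable_const_bound[where B=B]) auto
qed

text \<open>\<open>h\<close> is the distance to the complement. The whole space is treated apart
  because \<open>infdist\<close> to the empty set is 0 by convention.\<close>

lemma open_eq_positive_set:
  fixes U :: "'a::metric_space set"
  assumes "open U"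
  obtains h where "continuous_on UNIV h" "\<And>w. 0 \<le> h w" "U = {w. 0 < (h w :: real)}"
proof (cases "U = UNIV")
  case True
  then show ?thesis by (intro that[of "\<lambda>_. 1"]) auto
next
  case False
  have "w \<in> U \<longleftrightarrow> infdist w (- U) \<noteq> 0" for w
    using in_closed_iff_infdist_zero[of "- U" w] assms False by (auto simp: closed_def)
  then show ?thesis
    using infdist_nonneg[of _ "- U"]
    by (intro that[of "\<lambda>w. infdist w (- U)"]) (auto intro!: continuous_intros simp: less_le)
qed

text \<open>The k-th summand is the part of x between the heights k d and (k + 1) d. Applied to
  function values in [0, 1], this is the layer-cake decomposition used in
  \<open>representation\<close>.\<close>

lemma sum_slices:
  fixes x d :: real
  assumes "x \<ge> 0" "d \<ge> 0"
  shows "(\<Sum>k<n. min d (max 0 (x - real k * d))) = min x (real n * d)"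
proof (induction n)
  case (Suc n)
  then show ?case using assms by (auto simp: min_def max_def algebra_simps)
qed (use assms in auto)

text \<open>The open sets are an intersection-stable generator, and the indicator of {h > 0} is the
  dominated limit of the functions min 1 (n h) in \<open>Cb\<close>.\<close>

lemma borel_probs_eqI:
  fixes M N :: "'a::metric_space measure"
  assumes M: "M \<in> borel_probs" and N: "N \<in> borel_probs"
    and eq: "\<And>X. X \<in> Cb \<Longrightarrow> (\<integral>w. X w \<partial>M) = (\<integral>w. X w \<partial>N)"
  shows "M = N"
proof -
  have lim: "(\<lambda>n. \<integral>w. min 1 (real n * h w) \<partial>P) \<longlonglongrightarrow> measure P {w. 0 < h w}"
    if P: "P \<in> borel_probs" and h: "continuous_on UNIV h" "\<And>w. 0 \<le> h w"
    for P :: "'a measure" and h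
  proof -
    interpret prob_space P using P by (simp add: borel_probs_def)
    have sets: "sets P = sets borel" using P by (simp add: borel_probs_def)
    have meas: "h \<in> borel_measurable P"
      using borel_measurable_continuous_onI[OF h(1)] sets by (simp cong: measurable_cong_sets)
    have U: "{w. 0 < h w} \<in> sets P"
      unfolding sets using h(1) by (intro borel_open open_Collect_less) auto
    have "(\<lambda>n. \<integral>w. min 1 (real n * h w) \<partial>P) \<longlonglongrightarrow> (\<integral>w. indicator {w. 0 < h w} w \<partial>P)"
    proof (rule integral_dominated_convergence[where w="\<lambda>_. 1"])
      show "AE w in P. (\<lambda>n. min 1 (real n * h w)) \<longlonglongrightarrow> indicator {w. 0 < h w} w"
      proof (rule AE_I2)
        fix w
        show "(\<lambda>n. min 1 (real n * h w)) \<longlonglongrightarrow> indicator {w. 0 < h w} w"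
        proof (cases "h w = 0")
          case False
          then have pos: "0 < h w" using h(2)[of w] by simp
          obtain n0 :: nat where n0: "1 / h w \<le> real n0" using real_arch_simple by blast
          have "1 \<le> real n * h w" if "n \<ge> n0" for n
          proof -
            have "1 / h w \<le> real n" using n0 that by linarith
            then show ?thesis using pos by (simp add: pos_divide_le_eq)
          qed
          then have "eventually (\<lambda>n. min 1 (real n * h w) = 1) sequentially"
            by (intro eventually_sequentiallyI[of n0]) auto
          then show ?thesis using pos by (simp add: tendsto_eventually)
        qed simp
      qed
      show "AE w in P. norm (min 1 (real n * h w)) \<le> 1" for n
        using h(2) by (intro AE_I2) (auto simp: abs_le_iff min_le_iff_disj)
    qed (use meas U in auto)
    then show ?thesis using U by simp
  qed
  show ?thesis
  proof (rule measure_eqI_generator_eq[where E="{S. open S}" and \<Omega>=UNIV and A="\<lambda>_. UNIV"])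
    fix S :: "'a set" assume "S \<in> {S. open S}"
    then obtain h where h: "continuous_on UNIV h" "\<And>w. 0 \<le> h w" "S = {w. 0 < (h w :: real)}"
      using open_eq_positive_set by blast
    have "(\<lambda>w. min 1 (real n * h w)) \<in> Cb" for n
      using h(1,2) by (intro CbI[where B=1]) (auto intro!: continuous_intros simp: abs_le_iff min_le_iff_disj)
    then have "measure M S = measure N S"
      using lim[OF M h(1,2)] lim[OF N h(1,2)] eq h(3) by (simp add: LIMSEQ_unique)
    then show "emeasure M S = emeasure N S"
      using M N by (simp add: borel_probs_def finite_measure.emeasure_eq_measure prob_space_def)
  qed (use M N in \<open>auto simp: borel_probs_def borel_def Int_stable_def finite_measure.emeasure_eq_measure prob_space_def\<close>)
qed

section \<open>Construction of the representing measure\<close>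

locale daniell_functional =
  fixes l :: "('a::metric_space \<Rightarrow> real) \<Rightarrow> real"
  assumes add: "X \<in> Cb \<Longrightarrow> Y \<in> Cb \<Longrightarrow> l (\<lambda>w. X w + Y w) = l X + l Y"
    and scale: "X \<in> Cb \<Longrightarrow> l (\<lambda>w. c * X w) = c * l X"
    and nonneg: "X \<in> Cb \<Longrightarrow> (\<And>w. 0 \<le> X w) \<Longrightarrow> 0 \<le> l X"
    and decreasing: "(\<And>n. Xs n \<in> Cb) \<Longrightarrow> (\<And>w. decseq (\<lambda>n. Xs n w)) \<Longrightarrow>
      (\<And>w. (\<lambda>n. Xs n w) \<longlonglongrightarrow> 0) \<Longrightarrow> (\<lambda>n. l (Xs n)) \<longlonglongrightarrow> 0"
    and one: "l (\<lambda>_. 1) = 1"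
begin

lemma minus: "X \<in> Cb \<Longrightarrow> l (\<lambda>w. - X w) = - l X"
  using scale[of X "-1"] by simp

lemma diff: "X \<in> Cb \<Longrightarrow> Y \<in> Cb \<Longrightarrow> l (\<lambda>w. X w - Y w) = l X - l Y"
  using add[of X "\<lambda>w. - Y w"] minus[of Y] by auto

lemma const: "l (\<lambda>_. c) = c"
  using scale[of "\<lambda>_. 1" c] one by simp

lemma mono: "X \<in> Cb \<Longrightarrow> Y \<in> Cb \<Longrightarrow> (\<And>w. X w \<le> Y w) \<Longrightarrow> l X \<le> l Y"
  using nonneg[of "\<lambda>w. Y w - X w"] diff[of Y X] by auto

lemma sum: "finite I \<Longrightarrow> (\<And>i. i \<in> I \<Longrightarrow> X i \<in> Cb) \<Longrightarrow> l (\<lambda>w. \<Sum>i\<in>I. X i w) = (\<Sum>i\<in>I. l (X i))"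
proof (induction I rule: finite_induct)
  case empty then show ?case using const[of 0] by simp
next
  case (insert i I) then show ?case using add[of "X i" "\<lambda>w. \<Sum>i\<in>I. X i w"] by (auto simp: Cb_sum)
qed

text \<open>The remainders of the series decrease to 0 pointwise, so Daniell's condition
  \<open>decreasing\<close> applies to them.\<close>

lemma sums:
  assumes X: "\<And>i. X i \<in> Cb" "\<And>i w. 0 \<le> X i w" and Y: "Y \<in> Cb" "\<And>w. (\<lambda>i. X i w) sums Y w"
  shows "(\<lambda>i. l (X i)) sums l Y"
proof -
  have "(\<lambda>n. l (\<lambda>w. Y w - (\<Sum>i<n. X i w))) \<longlonglongrightarrow> 0"
  proof (rule decreasing)
    show "decseq (\<lambda>n. Y w - (\<Sum>i<n. X i w))" for w
      using X(2) by (intro decseq_SucI) simp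
    show "(\<lambda>n. Y w - (\<Sum>i<n. X i w)) \<longlonglongrightarrow> 0" for w
      using tendsto_diff[OF tendsto_const Y(2)[of w, unfolded sums_def], of "Y w"] by simp
  qed (use X Y in \<open>auto intro!: Cb_diff Cb_sum\<close>)
  moreover have "l (\<lambda>w. Y w - (\<Sum>i<n. X i w)) = l Y - (\<Sum>i<n. l (X i))" for n
    using X Y by (subst diff) (auto simp: sum intro!: Cb_sum)
  ultimately have "(\<lambda>n. l Y - (\<Sum>i<n. l (X i))) \<longlonglongrightarrow> 0" by simp
  from tendsto_diff[OF tendsto_const this, of "l Y"] show ?thesis by (simp add: sums_def)
qed

text \<open>\<open>l\<close> does not act on indicators of sets, but it can measure the region
  between two graphs. Half-open strips form a semiring, ready for Caratheodory's theorem.\<close>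

definition strip :: "('a \<Rightarrow> real) \<Rightarrow> ('a \<Rightarrow> real) \<Rightarrow> ('a \<times> real) set" where
  "strip f g = {(w, t). f w \<le> t \<and> t < g w}"

definition strips :: "('a \<times> real) set set" where
  "strips = {strip f g | f g. f \<in> Cb \<and> g \<in> Cb \<and> (\<forall>w. f w \<le> g w)}"

text \<open>Section lengths are used since a strip does not determine \<open>f\<close> and
  \<open>g\<close> where they coincide, whereas g - f is recovered from the lengths.\<close>

definition strip_measure :: "('a \<times> real) set \<Rightarrow> ennreal" where
  "strip_measure S = ennreal (l (\<lambda>w. measure lborel {t. (w, t) \<in> S}))"

lemma section_strip: "{t. (w, t) \<in> strip f g} = {f w..<g w}"
  by (auto simp: strip_def)

lemma strip_measure_strip:
  "(\<And>w. f w \<le> g w) \<Longrightarrow> strip_measure (strip f g) = ennreal (l (\<lambda>w. g w - f w))"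
  by (simp add: strip_measure_def section_strip)

lemma strip_in_strips: "f \<in> Cb \<Longrightarrow> g \<in> Cb \<Longrightarrow> (\<And>w. f w \<le> g w) \<Longrightarrow> strip f g \<in> strips"
  by (auto simp: strips_def)

lemma strips_cases:
  assumes "S \<in> strips"
  obtains f g where "S = strip f g" "f \<in> Cb" "g \<in> Cb" "\<And>w. f w \<le> g w"
  using assms by (auto simp: strips_def)

lemma semiring_strips: "semiring_of_sets UNIV strips"
proof
  show "{} \<in> strips"
  proof -
    have "strip (\<lambda>_. 0) (\<lambda>_. 0) = {}" by (auto simp: strip_def)
    then show ?thesis using strip_in_strips[of "\<lambda>_. 0" "\<lambda>_. 0"] by simp
  qed
  fix a b assume "a \<in> strips" "b \<in> strips"
  then obtain f g f' g' where a: "a = strip f g" "f \<in> Cb" "g \<in> Cb" "\<And>w. f w \<le> g w"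
    and b: "b = strip f' g'" "f' \<in> Cb" "g' \<in> Cb" "\<And>w. f' w \<le> g' w"
    by (metis strips_cases)
  \<comment> \<open>The outer \<open>max\<close> keeps the upper graph above the lower one at points
    whose sections do not meet; the section there is empty, as it should be. The difference is
    clamped in the same way.\<close>
  have "a \<inter> b = strip (\<lambda>w. max (f w) (f' w)) (\<lambda>w. max (max (f w) (f' w)) (min (g w) (g' w)))"
    using a(1) b(1) by (auto simp: strip_def)
  then show "a \<inter> b \<in> strips"
    using a b by (auto intro!: strip_in_strips)
  \<comment> \<open>A section of \<open>a - b\<close> consists of a part below f' and a part from g'
    on.\<close>
  define S T where "S = strip f (\<lambda>w. max (f w) (min (g w) (f' w)))"
    and "T = strip (\<lambda>w. max (f w) (g' w)) (\<lambda>w. max (max (f w) (g' w)) (g w))"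
  have "S \<in> strips" "T \<in> strips" using a b by (auto simp: S_def T_def intro!: strip_in_strips)
  moreover have "a - b = \<Union>{S, T}"
    using a(1) b(1) order_trans[OF b(4)] by (auto simp: strip_def S_def T_def)
  moreover have "S \<inter> T = {}"
    using order_trans[OF b(4)] by (fastforce simp: strip_def S_def T_def)
  then have "disjoint {S, T}" by (auto simp: disjoint_def)
  ultimately show "\<exists>C\<subseteq>strips. finite C \<and> disjoint C \<and> a - b = \<Union>C"
    by (intro exI[of _ "{S, T}"]) auto
qed simp

text \<open>Over each point the sections are disjoint intervals, so countable additivity of Lebesgue
  measure makes the g i - f i sum to G - F; \<open>sums\<close> then carries \<open>l\<close>
  through the series.\<close>

lemma countably_additive_strip_measure: "countably_additive strips strip_measure"
proof (rule countably_additiveI)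
  fix A :: "nat \<Rightarrow> ('a \<times> real) set"
  assume A: "range A \<subseteq> strips" and disj: "disjoint_family A" and UA: "(\<Union>i. A i) \<in> strips"
  have "\<exists>f g. A i = strip f g \<and> f \<in> Cb \<and> g \<in> Cb \<and> (\<forall>w. f w \<le> g w)" for i
    using subsetD[OF A rangeI[of A i]] by (simp add: strips_def)
  then obtain f g where fg: "\<And>i. A i = strip (f i) (g i)" "\<And>i. f i \<in> Cb" "\<And>i. g i \<in> Cb"
    "\<And>i w. f i w \<le> g i w" by metis
  obtain F G where FG: "(\<Union>i. A i) = strip F G" "F \<in> Cb" "G \<in> Cb" "\<And>w. F w \<le> G w"
    using UA by (metis strips_cases)
  have "(\<lambda>i. g i w - f i w) sums (G w - F w)" for w
  proof -
    have U: "(\<Union>i. {f i w..<g i w}) = {F w..<G w}"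
      using FG(1) unfolding section_strip[symmetric] fg(1)[symmetric] by auto
    moreover have "range (\<lambda>i. {f i w..<g i w}) \<subseteq> sets lborel" by auto
    moreover have "disjoint_family (\<lambda>i. {f i w..<g i w})"
      using disj unfolding section_strip[symmetric] fg(1)[symmetric] disjoint_family_on_def by blast
    ultimately have "(\<lambda>i. measure lborel {f i w..<g i w}) sums measure lborel {F w..<G w}"
      using measure_UNION[of "\<lambda>i. {f i w..<g i w}" lborel] FG(4) by simp
    then show ?thesis using fg(4) FG(4) by (simp add: measure_def)
  qed
  then have "(\<lambda>i. l (\<lambda>w. g i w - f i w)) sums l (\<lambda>w. G w - F w)"
    using fg FG by (intro sums) auto
  moreover have "0 \<le> l (\<lambda>w. g i w - f i w)" "0 \<le> l (\<lambda>w. G w - F w)" for i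
    using fg FG by (auto intro!: nonneg)
  ultimately have "(\<lambda>i. ennreal (l (\<lambda>w. g i w - f i w))) sums ennreal (l (\<lambda>w. G w - F w))"
    by simp
  then show "(\<Sum>i. strip_measure (A i)) = strip_measure (\<Union> (range A))"
    using fg FG by (simp add: strip_measure_strip sums_iff)
qed

lemma strip_measure_extension:
  obtains N where "space N = UNIV" "strips \<subseteq> sets N"
    "\<And>f g. f \<in> Cb \<Longrightarrow> g \<in> Cb \<Longrightarrow> (\<And>w. f w \<le> g w) \<Longrightarrow> emeasure N (strip f g) = ennreal (l (\<lambda>w. g w - f w))"
proof -
  interpret semiring_of_sets UNIV strips by (rule semiring_strips)
  have "positive strips strip_measure"
    using const[of 0] by (simp add: positive_def strip_measure_def)
  then obtain \<mu> where \<mu>: "\<And>s. s \<in> strips \<Longrightarrow> \<mu> s = strip_measure s"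
    and ms: "measure_space UNIV (sigma_sets UNIV strips) \<mu>"
    using caratheodory[OF _ countably_additive_strip_measure] by auto
  define N where "N = measure_of UNIV strips \<mu>"
  have sp: "space N = UNIV" "sets N = sigma_sets UNIV strips" by (auto simp: N_def)
  have "emeasure N s = \<mu> s" if "s \<in> sigma_sets UNIV strips" for s
    using that ms unfolding N_def by (simp add: emeasure_measure_of_conv)
  then show ?thesis
    using sp \<mu> by (intro that[of N]) (auto simp: strip_measure_strip strip_in_strips sigma_sets.Basic)
qed

text \<open>The representing measure of \<open>A\<close> is the measure of \<open>A \<times> [0, 1)\<close>; for open \<open>A\<close> this set is an
  increasing union of strips.\<close>

lemma exists_measure:
  obtains M where "M \<in> borel_probs"
    "\<And>h. continuous_on UNIV h \<Longrightarrow> (\<And>w. 0 \<le> h w) \<Longrightarrow>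
       (\<lambda>n. l (\<lambda>w. min 1 (real n * h w))) \<longlonglongrightarrow> measure M {w. 0 < h w}"
proof -
  obtain N where N: "space N = UNIV" "strips \<subseteq> sets N"
    "\<And>f g. f \<in> Cb \<Longrightarrow> g \<in> Cb \<Longrightarrow> (\<And>w. f w \<le> g w) \<Longrightarrow> emeasure N (strip f g) = ennreal (l (\<lambda>w. g w - f w))"
    by (rule strip_measure_extension) blast
  define s where "s h n = strip (\<lambda>_. 0) (\<lambda>w. min 1 (real n * h w))" for h :: "'a \<Rightarrow> real" and n
  have cb: "(\<lambda>w. min 1 (real n * h w)) \<in> Cb"
    if "continuous_on UNIV h" "\<And>w. 0 \<le> h w" for h :: "'a \<Rightarrow> real" and n
    using that by (intro CbI[where B=1]) (auto intro!: continuous_intros simp: abs_le_iff min_le_iff_disj)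
  have s_sets: "s h n \<in> sets N" and s_em: "emeasure N (s h n) = ennreal (l (\<lambda>w. min 1 (real n * h w)))"
    if "continuous_on UNIV h" "\<And>w. 0 \<le> h w" for h n
    using cb[OF that] that N(2) N(3)[of "\<lambda>_. 0" "\<lambda>w. min 1 (real n * h w)"]
    by (auto simp: s_def intro!: strip_in_strips)
  have UN: "(\<Union>n. s h n) = {w. 0 < h w} \<times> {0..<1}" if nn: "\<And>w. 0 \<le> h w" for h
  proof (intro set_eqI iffI)
    fix z assume "z \<in> {w. 0 < h w} \<times> {0..<1::real}"
    then obtain w t where z: "z = (w, t)" "0 < h w" "0 \<le> t" "t < 1" by auto
    obtain n where "t < real n * h w" using z(2) reals_Archimedean3 by blast
    then have "z \<in> s h n" using z by (auto simp: s_def strip_def)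
    then show "z \<in> (\<Union>n. s h n)" by blast
  next
    fix z assume "z \<in> (\<Union>n. s h n)"
    then obtain n w t where "z = (w, t)" "0 \<le> t" "t < 1" "t < real n * h w"
      by (auto simp: s_def strip_def)
    then show "z \<in> {w. 0 < h w} \<times> {0..<1}"
      using nn[of w] by (cases "h w = 0") (auto simp: less_le)
  qed
  have cyl: "U \<times> {0..<1} \<in> sets N" if "open U" for U
  proof -
    obtain h where h: "continuous_on UNIV h" "\<And>w. 0 \<le> h w" "U = {w. 0 < (h w :: real)}"
      by (rule open_eq_positive_set[OF \<open>open U\<close>]) blast
    then have "(\<Union>n. s h n) \<in> sets N" using s_sets by blast
    then show ?thesis using UN h by simp
  qed
  \<comment> \<open>At heights in [0, 1), the set A \<times> [0, 1) is the preimage of A under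
    \<open>fst\<close>, so its measurability has to be checked for open A only.\<close>
  define N' where "N' = restrict_space N (UNIV \<times> {0..<1})"
  have sp: "space N' = UNIV \<times> {0..<1}" by (simp add: N'_def space_restrict_space N)
  have UN1: "UNIV \<times> {0..<1} \<inter> space N \<in> sets N" using cyl[of UNIV] N by simp
  have setsN': "S \<in> sets N' \<longleftrightarrow> S \<subseteq> UNIV \<times> {0..<1} \<and> S \<in> sets N" for S
    unfolding N'_def using sets_restrict_space_iff[OF UN1] by auto
  have fst: "fst \<in> measurable N' borel"
  proof (rule borel_measurableI)
    fix S :: "'a set" assume "open S"
    moreover have "fst -` S \<inter> space N' = S \<times> {0..<1}" by (auto simp: sp)
    ultimately show "fst -` S \<inter> space N' \<in> sets N'" using cyl by (auto simp: setsN')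
  qed
  define M where "M = distr N' borel fst"
  have emM: "emeasure M A = emeasure N (A \<times> {0..<1})" if "A \<in> sets borel" for A
  proof -
    have "fst -` A \<inter> space N' = A \<times> {0..<1}" by (auto simp: sp)
    then have "emeasure M A = emeasure N' (A \<times> {0..<1})"
      using that fst by (simp add: M_def emeasure_distr)
    then show ?thesis unfolding N'_def using UN1 by (subst (asm) emeasure_restrict_space) auto
  qed
  have "UNIV \<times> {0..<1} = strip (\<lambda>_::'a. 0) (\<lambda>_. 1)" by (auto simp: strip_def)
  then have "emeasure M UNIV = 1" using emM[of UNIV] N(3)[of "\<lambda>_. 0" "\<lambda>_. 1"] const[of 1] by simp
  then have M: "prob_space M" by (intro prob_spaceI) (simp add: M_def)
  show ?thesis
  proof (rule that)
    show "M \<in> borel_probs" using M by (simp add: borel_probs_def M_def)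
    fix h :: "'a \<Rightarrow> real" assume h: "continuous_on UNIV h" "\<And>w. 0 \<le> h w"
    interpret M: prob_space M by (rule M)
    have "incseq (s h)"
    proof (rule incseq_SucI)
      fix n
      have "real n * h w \<le> real (Suc n) * h w" for w using h(2)[of w] by (intro mult_right_mono) auto
      then show "s h n \<subseteq> s h (Suc n)" unfolding s_def strip_def by (fastforce intro: less_le_trans)
    qed
    then have "(\<lambda>n. emeasure N (s h n)) \<longlonglongrightarrow> emeasure N (\<Union>n. s h n)"
      using s_sets[OF h] by (intro Lim_emeasure_incseq) auto
    moreover have "emeasure N (\<Union>n. s h n) = ennreal (measure M {w. 0 < h w})"
    proof -
      have "open {w. 0 < h w}" using h(1) by (intro open_Collect_less) auto
      then show ?thesis using UN[OF h(2)] emM[of "{w. 0 < h w}"]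
        by (simp add: M.emeasure_eq_measure)
    qed
    moreover have "0 \<le> l (\<lambda>w. min 1 (real n * h w))" for n
      using cb[OF h] h(2) by (intro nonneg) auto
    ultimately show "(\<lambda>n. l (\<lambda>w. min 1 (real n * h w))) \<longlonglongrightarrow> measure M {w. 0 < h w}"
      using s_em[OF h] by (simp add: tendsto_ennreal_iff)
  qed
qed

text \<open>\<open>exists_measure\<close> links \<open>l\<close> and \<open>M\<close> only on sets
  {h > 0}. This suffices: for 0 \<le> f \<le> 1 and a slice of thickness d above height c, both
  \<open>l\<close> and the integral lie between d M{f > c + d} and d M{f > c}, and over all slices
  these bounds differ by a telescoping sum of at most d.\<close>

lemma representation:
  obtains M where "M \<in> borel_probs" "\<And>X. X \<in> Cb \<Longrightarrow> l X = (\<integral>w. X w \<partial>M)"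
proof -
  obtain M where M: "M \<in> borel_probs" and lim: "\<And>h. continuous_on UNIV h \<Longrightarrow> (\<And>w. 0 \<le> h w) \<Longrightarrow>
       (\<lambda>n. l (\<lambda>w. min 1 (real n * h w))) \<longlonglongrightarrow> measure M {w. 0 < h w}"
    by (rule exists_measure) blast
  interpret prob_space M using M by (simp add: borel_probs_def)
  have sets: "sets M = sets borel" using M by (simp add: borel_probs_def)
  have unit: "l f = (\<integral>w. f w \<partial>M)" if f: "f \<in> Cb" "\<And>w. 0 \<le> f w" "\<And>w. f w \<le> 1" for f
  proof -
    define U where "U c = {w. c < f w}" for c
    have U_sets: "U c \<in> sets M" for c
      unfolding U_def sets using f(1) by (intro borel_open open_Collect_less) (auto intro: Cb_continuous)
    have cbs: "(\<lambda>w. min d (max 0 (f w - c))) \<in> Cb" for c d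
      using f(1) by (intro Cb_min Cb_max Cb_diff Cb_const)
    have h: "continuous_on UNIV (\<lambda>w. max 0 (f w - c))" for c
      using Cb_continuous[OF f(1)] by (intro continuous_intros)
    have lim': "(\<lambda>n. l (\<lambda>w. min 1 (real n * max 0 (f w - c)))) \<longlonglongrightarrow> prob (U c)" for c
    proof -
      have "{w. 0 < max 0 (f w - c)} = U c" by (auto simp: U_def)
      then show ?thesis using lim[OF h[of c]] by simp
    qed
    have cbn: "(\<lambda>w. min 1 (r * max 0 (f w - c))) \<in> Cb" for r c
      using f(1) by (intro Cb_min Cb_scale Cb_max Cb_diff Cb_const)
    have l_upper: "l (\<lambda>w. min d (max 0 (f w - c))) \<le> d * prob (U c)" if d: "d > 0" for c d
    proof -
      \<comment> \<open>For n \<ge> 1/d the function d min 1 (n max 0 (f - c)) dominates the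
        slice.\<close>
      obtain n0 :: nat where n0: "1 / d \<le> real n0" using real_arch_simple by blast
      have "l (\<lambda>w. min d (max 0 (f w - c))) \<le> d * l (\<lambda>w. min 1 (real n * max 0 (f w - c)))" if "n \<ge> n0" for n
      proof -
        have n: "1 \<le> d * real n" using n0 that d by (simp add: field_simps) (smt (verit) mult_left_mono of_nat_mono)
        have "min d (max 0 (f w - c)) \<le> d * min 1 (real n * max 0 (f w - c))" for w
          using mult_right_mono[OF n, of "max 0 (f w - c)"] d
          by (auto simp: min_mult_distrib_left mult.assoc intro!: min.mono)
        then have "l (\<lambda>w. min d (max 0 (f w - c))) \<le> l (\<lambda>w. d * min 1 (real n * max 0 (f w - c)))"
          by (intro mono cbs Cb_scale cbn)
        then show ?thesis by (simp add: scale cbn)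
      qed
      then show ?thesis
        by (intro LIMSEQ_le_const[OF tendsto_mult_left[OF lim']]) blast
    qed
    have l_lower: "d * prob (U (c + d)) \<le> l (\<lambda>w. min d (max 0 (f w - c)))" if d: "d > 0" for c d
    proof (rule LIMSEQ_le_const2[OF tendsto_mult_left[OF lim']], intro exI allI impI)
      fix n :: nat
      \<comment> \<open>Where f exceeds c + d the slice has its full height d; elsewhere the left
        side is 0.\<close>
      have "d * min 1 (real n * max 0 (f w - (c + d))) \<le> min d (max 0 (f w - c))" for w
        using d by (cases "f w \<le> c + d") (auto simp: min_def max_def mult_le_cancel_left1)
      then have "l (\<lambda>w. d * min 1 (real n * max 0 (f w - (c + d)))) \<le> l (\<lambda>w. min d (max 0 (f w - c)))"
        by (intro mono cbs Cb_scale cbn)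
      then show "d * l (\<lambda>w. min 1 (real n * max 0 (f w - (c + d)))) \<le> l (\<lambda>w. min d (max 0 (f w - c)))"
        by (simp add: scale cbn)
    qed
    have i_ind: "(\<integral>w. d * indicator (U c) w \<partial>M) = d * prob (U c)" "integrable M (\<lambda>w. d * indicator (U c) w :: real)" for c d
      using U_sets[of c] by (auto intro!: integrable_mult_right integrable_real_indicator simp: emeasure_eq_measure)
    have i_upper: "(\<integral>w. min d (max 0 (f w - c)) \<partial>M) \<le> d * prob (U c)" if "d > 0" for c d
      unfolding i_ind(1)[symmetric] using that
      by (intro integral_mono Cb_integrable[OF M] cbs i_ind) (auto simp: U_def indicator_def)
    have i_lower: "d * prob (U (c + d)) \<le> (\<integral>w. min d (max 0 (f w - c)) \<partial>M)" if "d > 0" for c d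
      unfolding i_ind(1)[symmetric] using that
      by (intro integral_mono Cb_integrable[OF M] cbs i_ind) (auto simp: U_def indicator_def)
    have "\<bar>l f - (\<integral>w. f w \<partial>M)\<bar> \<le> 1 / real (Suc n)" for n
    proof -
      define d where "d = 1 / real (Suc n)"
      define sl where "sl k w = min d (max 0 (f w - real k * d))" for k w
      have d: "d > 0" "real (Suc n) * d = 1" by (auto simp: d_def)
      have f_eq: "f = (\<lambda>w. \<Sum>k<Suc n. sl k w)"
        unfolding sl_def using d f(2,3) by (subst sum_slices) (auto simp: fun_eq_iff)
      have slcb: "sl k \<in> Cb" for k unfolding sl_def[abs_def] by (rule cbs)
      have "l f - (\<integral>w. f w \<partial>M) = (\<Sum>k<Suc n. l (sl k) - (\<integral>w. sl k w \<partial>M))"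
        unfolding f_eq using slcb
        by (subst sum, simp, simp, subst Bochner_Integration.integral_sum)
           (auto simp: sum_subtractf intro!: Cb_integrable[OF M] slcb)
      also have "\<bar>\<dots>\<bar> \<le> (\<Sum>k<Suc n. \<bar>l (sl k) - (\<integral>w. sl k w \<partial>M)\<bar>)" by (rule sum_abs)
      also have "\<dots> \<le> (\<Sum>k<Suc n. d * prob (U (real k * d)) - d * prob (U (real (Suc k) * d)))"
      proof (rule sum_mono)
        fix k
        have e: "real k * d + d = real (Suc k) * d" by (simp add: algebra_simps)
        show "\<bar>l (sl k) - (\<integral>w. sl k w \<partial>M)\<bar> \<le> d * prob (U (real k * d)) - d * prob (U (real (Suc k) * d))"
          using l_upper[OF d(1), of "real k * d"] l_lower[OF d(1), of "real k * d"]
            i_upper[OF d(1), of "real k * d"] i_lower[OF d(1), of "real k * d"]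
          unfolding sl_def[abs_def] e by (simp add: abs_le_iff)
      qed
      also have "\<dots> = d * prob (U 0) - d * prob (U (real (Suc n) * d))"
        using sum_lessThan_telescope'[of "\<lambda>k. d * prob (U (real k * d))" "Suc n"] by simp
      also have "\<dots> \<le> d * 1 - 0"
        using d(1) by (intro diff_mono mult_left_mono) auto
      finally show ?thesis by (simp add: d_def)
    qed
    then have "\<bar>l f - (\<integral>w. f w \<partial>M)\<bar> \<le> 0"
      by (intro LIMSEQ_le_const[OF LIMSEQ_Suc[OF lim_1_over_n]]) auto
    then show ?thesis by simp
  qed
  have "l X = (\<integral>w. X w \<partial>M)" if X: "X \<in> Cb" for X
  proof -
    obtain B where B: "B > 0" "\<And>w. \<bar>X w\<bar> \<le> B" using X by (metis Cb_bound)
    \<comment> \<open>The affine map takes [-B, B] onto [0, 1], where \<open>unit\<close>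
      applies.\<close>
    define f where "f w = (1 / (2 * B)) * (X w + B)" for w
    have f: "f \<in> Cb" unfolding f_def[abs_def] using X by (intro Cb_scale Cb_add Cb_const)
    have "0 \<le> f w" "f w \<le> 1" for w
      using B(1) B(2)[of w] by (auto simp: f_def field_simps abs_le_iff)
    then have "l f = (\<integral>w. f w \<partial>M)" by (intro unit f)
    moreover have Xf: "X = (\<lambda>w. 2 * B * f w - B)" using B(1) by (simp add: f_def fun_eq_iff)
    have "l X = 2 * B * l f - B"
      unfolding Xf using f by (subst diff) (auto simp: scale const)
    moreover have "(\<integral>w. X w \<partial>M) = 2 * B * (\<integral>w. f w \<partial>M) - B"
      unfolding Xf using Cb_integrable[OF M f] by (simp add: prob_space)
    ultimately show ?thesis by simp
  qed
  with M that show ?thesis by blast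
qed

end

section \<open>Monotone approximation of continuous functions\<close>

text \<open>Strict epigraphs of continuous functions are open in the second countable product with
  the real line. Lindeloef's theorem keeps countably many with the same union, that is, with the
  same pointwise infimum; running minima make them decrease.\<close>

lemma decreasing_sequence_to_infimum:
  fixes h :: "'a::second_countable_topology \<Rightarrow> real" and S :: "('a \<Rightarrow> real) set"
  assumes cont: "\<And>Y. Y \<in> S \<Longrightarrow> continuous_on UNIV Y"
    and ge: "\<And>Y w. Y \<in> S \<Longrightarrow> h w \<le> Y w"
    and min: "\<And>Y Z. Y \<in> S \<Longrightarrow> Z \<in> S \<Longrightarrow> (\<lambda>w. min (Y w) (Z w)) \<in> S"
    and inf: "\<And>w e. e > 0 \<Longrightarrow> \<exists>Y\<in>S. Y w < h w + e"
  obtains Y where "\<And>n::nat. Y n \<in> S" "\<And>w. decseq (\<lambda>n. Y n w)" "\<And>w. (\<lambda>n. Y n w) \<longlonglongrightarrow> h w"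
proof -
  define E where "E Y = {z. Y (fst z) < snd z}" for Y :: "'a \<Rightarrow> real"
  have "open (E Y)" if "Y \<in> S" for Y
    unfolding E_def
    by (intro open_Collect_less continuous_on_compose2[OF cont[OF that]]) (auto intro!: continuous_intros)
  then obtain F where F: "F \<subseteq> E ` S" "countable F" "\<Union>F = \<Union>(E ` S)"
    using Lindelof[of "E ` S"] by (metis imageE)
  obtain S' where S': "countable S'" "S' \<subseteq> S" "F = E ` S'"
    using countable_subset_image[of F E S] F(1,2) by auto
  have approx: "\<exists>Y\<in>S'. Y w < h w + e" if "e > 0" for w e
  proof -
    have "(w, h w + e) \<in> \<Union>F" using inf[OF that, of w] F(3) by (auto simp: E_def)
    then show ?thesis using S'(3) by (auto simp: E_def)
  qed
  then have "S' \<noteq> {}" by (metis empty_iff zero_less_one)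
  define y where "y = from_nat_into S'"
  have y: "y n \<in> S'" for n unfolding y_def using \<open>S' \<noteq> {}\<close> by (rule from_nat_into)
  define Y where "Y = rec_nat (y 0) (\<lambda>n f w. min (f w) (y (Suc n) w))"
  have Y0: "Y 0 = y 0" and YS: "Y (Suc n) = (\<lambda>w. min (Y n w) (y (Suc n) w))" for n
    by (auto simp: Y_def)
  have YinS: "Y n \<in> S" for n
    by (induction n) (use y S'(2) in \<open>auto simp: Y0 YS intro!: min\<close>)
  have dec: "decseq (\<lambda>n. Y n w)" for w by (rule decseq_SucI) (simp add: YS)
  have Yy: "Y n w \<le> y n w" for n w by (cases n) (auto simp: Y0 YS)
  have "(\<lambda>n. Y n w) \<longlonglongrightarrow> h w" for w
  proof (rule order_tendstoI)
    fix a assume "a < h w"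
    then show "\<forall>\<^sub>F n in sequentially. a < Y n w" using ge[OF YinS] by (intro always_eventually allI) (rule less_le_trans)
  next
    fix a assume "h w < a"
    then obtain Z where "Z \<in> S'" "Z w < a" using approx[of "a - h w" w] by auto
    moreover obtain n where "y n = Z"
      using \<open>Z \<in> S'\<close> S'(1) unfolding y_def by (metis from_nat_into_surj)
    ultimately have "Y m w < a" if "m \<ge> n" for m
      using Yy[of n w] decseqD[OF dec that, of w] by simp
    then show "\<forall>\<^sub>F n in sequentially. Y n w < a" by (auto simp: eventually_sequentially)
  qed
  with YinS dec that show ?thesis by blast
qed

text \<open>Only the vector lattice structure, so that \<open>L\<close> and \<open>Cb\<close> are
  both instances.\<close>

locale function_lattice =
  fixes L :: "('a::topological_space \<Rightarrow> real) set"
  assumes sub_Cb: "L \<subseteq> Cb"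
    and add: "X \<in> L \<Longrightarrow> Y \<in> L \<Longrightarrow> (\<lambda>w. X w + Y w) \<in> L"
    and scale: "X \<in> L \<Longrightarrow> (\<lambda>w. c * X w) \<in> L"
    and max: "X \<in> L \<Longrightarrow> Y \<in> L \<Longrightarrow> (\<lambda>w. max (X w) (Y w)) \<in> L"
    and const: "(\<lambda>_. c) \<in> L"
begin

lemma minus: "X \<in> L \<Longrightarrow> (\<lambda>w. - X w) \<in> L"
  using scale[of X "-1"] by simp

lemma diff: "X \<in> L \<Longrightarrow> Y \<in> L \<Longrightarrow> (\<lambda>w. X w - Y w) \<in> L"
  using add[of X "\<lambda>w. - Y w"] minus[of Y] by simp

lemma min: "X \<in> L \<Longrightarrow> Y \<in> L \<Longrightarrow> (\<lambda>w. min (X w) (Y w)) \<in> L"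
proof -
  assume "X \<in> L" "Y \<in> L"
  moreover have "(\<lambda>w. min (X w) (Y w)) = (\<lambda>w. - max (- X w) (- Y w))" by (auto simp: fun_eq_iff)
  ultimately show ?thesis using minus[OF max[OF minus minus]] by simp
qed

lemma abs: "X \<in> L \<Longrightarrow> (\<lambda>w. \<bar>X w\<bar>) \<in> L"
proof -
  assume "X \<in> L"
  moreover have "(\<lambda>w. \<bar>X w\<bar>) = (\<lambda>w. max (X w) (- X w))" by (auto simp: fun_eq_iff)
  ultimately show ?thesis using max[OF _ minus, of X X] by simp
qed

end

lemma function_lattice_Cb: "function_lattice Cb"
  by unfold_locales auto

lemma admissible_imp_function_lattice: "admissible_space L \<Longrightarrow> function_lattice L"
  unfolding admissible_space_def by unfold_locales auto

text \<open>Induction along the generation of the topology: |f - f x| / d serves a subbasic set,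
  maxima serve intersections, and for a union the function of one member containing the point is
  enough.\<close>

lemma admissible_separation:
  assumes L: "admissible_space L" and "open S" "x \<in> S"
  obtains g where "g \<in> L" "\<And>w. 0 \<le> g w" "g x = 0" "\<And>w. w \<notin> S \<Longrightarrow> 1 \<le> g w"
proof -
  interpret function_lattice L by (rule admissible_imp_function_lattice[OF L])
  have "generate_topology {f -` U | f U. f \<in> L \<and> open U} S"
    using L \<open>open S\<close> unfolding admissible_space_def by blast
  then have "\<forall>x\<in>S. \<exists>g\<in>L. (\<forall>w. 0 \<le> g w) \<and> g x = 0 \<and> (\<forall>w. w \<notin> S \<longrightarrow> 1 \<le> g w)"
  proof induction
    case UNIV
    then show ?case using const[of 0] by (intro ballI bexI[of _ "\<lambda>_. 0"]) auto
  next
    case (Int a b)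
    show ?case
    proof
      fix x assume "x \<in> a \<inter> b"
      then obtain g h where g: "g \<in> L" "\<forall>w. 0 \<le> g w" "g x = 0" "\<forall>w. w \<notin> a \<longrightarrow> 1 \<le> g w"
        and h: "h \<in> L" "\<forall>w. 0 \<le> h w" "h x = 0" "\<forall>w. w \<notin> b \<longrightarrow> 1 \<le> h w"
        using Int.IH by (metis IntE)
      then show "\<exists>g\<in>L. (\<forall>w. 0 \<le> g w) \<and> g x = 0 \<and> (\<forall>w. w \<notin> a \<inter> b \<longrightarrow> 1 \<le> g w)"
        by (intro bexI[of _ "\<lambda>w. max (g w) (h w)"] max) (auto simp: le_max_iff_disj)
    qed
  next
    case (UN K)
    show ?case
    proof
      fix x assume "x \<in> \<Union>K"
      then obtain k where k: "k \<in> K" "x \<in> k" by blast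
      then obtain g where g: "g \<in> L" "\<forall>w. 0 \<le> g w" "g x = 0" "\<forall>w. w \<notin> k \<longrightarrow> 1 \<le> g w"
        using UN.IH by metis
      then show "\<exists>g\<in>L. (\<forall>w. 0 \<le> g w) \<and> g x = 0 \<and> (\<forall>w. w \<notin> \<Union>K \<longrightarrow> 1 \<le> g w)"
        using k(1) by (intro bexI[of _ g]) auto
    qed
  next
    case (Basis s)
    then obtain f U where s: "s = f -` U" "f \<in> L" "open U" by auto
    show ?case
    proof
      fix x assume "x \<in> s"
      then obtain d where d: "d > 0" "\<And>y. \<bar>y - f x\<bar> < d \<Longrightarrow> y \<in> U"
        using s(1,3) unfolding open_dist dist_real_def by (metis vimageD)
      have "(\<lambda>w. (1/d) * \<bar>f w - f x\<bar>) \<in> L" using s by (intro scale abs diff const)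
      moreover have "1 \<le> (1/d) * \<bar>f w - f x\<bar>" if "w \<notin> s" for w
        using d that s by (force simp: field_simps)
      ultimately show "\<exists>g\<in>L. (\<forall>w. 0 \<le> g w) \<and> g x = 0 \<and> (\<forall>w. w \<notin> s \<longrightarrow> 1 \<le> g w)"
        using d(1) by (intro bexI[of _ "\<lambda>w. (1/d) * \<bar>f w - f x\<bar>"]) auto
    qed
  qed
  with \<open>x \<in> S\<close> that show ?thesis by blast
qed

lemma admissible_upper_approx:
  assumes L: "admissible_space L" and X: "X \<in> Cb" and e: "e > 0"
  shows "\<exists>Y\<in>L. (\<forall>w. X w \<le> Y w) \<and> Y x < X x + e"
proof -
  interpret function_lattice L by (rule admissible_imp_function_lattice[OF L])
  obtain B where B: "B > 0" "\<And>w. \<bar>X w\<bar> \<le> B" using X by (metis Cb_bound)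
  have "open {w. X w < X x + e / 2}"
    using Cb_continuous[OF X] by (intro open_Collect_less) auto
  then obtain g where g: "g \<in> L" "\<And>w. 0 \<le> g w" "g x = 0" "\<And>w. \<not> X w < X x + e / 2 \<Longrightarrow> 1 \<le> g w"
    using admissible_separation[OF L, of "{w. X w < X x + e / 2}" x] e by auto
  \<comment> \<open>Where X < X x + e / 2 the constant is enough; elsewhere g \<ge> 1, and 2 B
    bounds the oscillation of X.\<close>
  define Y where "Y w = (X x + e / 2) + 2 * B * g w" for w
  have "Y \<in> L" unfolding Y_def[abs_def] using g by (intro add const scale)
  moreover have "X w \<le> Y w" for w
  proof (cases "X w < X x + e / 2")
    case True then show ?thesis using g(2)[of w] B(1) by (simp add: Y_def add_increasing2)
  next
    case False
    then have "2 * B * 1 \<le> 2 * B * g w" using g(4) B(1) by (intro mult_left_mono) auto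
    then show ?thesis using B(2)[of w] B(2)[of x] e by (simp add: Y_def abs_le_iff)
  qed
  ultimately show ?thesis using e g(3) by (intro bexI[of _ Y]) (auto simp: Y_def)
qed

lemma admissible_decreasing_sequence:
  fixes L :: "('a::second_countable_topology \<Rightarrow> real) set"
  assumes L: "admissible_space L" and X: "X \<in> Cb"
  obtains Y where "\<And>n::nat. Y n \<in> L" "\<And>n w. X w \<le> Y n w"
    "\<And>w. decseq (\<lambda>n. Y n w)" "\<And>w. (\<lambda>n. Y n w) \<longlonglongrightarrow> X w"
proof -
  interpret function_lattice L by (rule admissible_imp_function_lattice[OF L])
  note result = that
  show ?thesis
  proof (rule decreasing_sequence_to_infimum[of "{Y\<in>L. \<forall>w. X w \<le> Y w}" X])
    show "\<exists>Y\<in>{Y\<in>L. \<forall>w. X w \<le> Y w}. Y w < X w + e" if "e > 0" for w e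
      using admissible_upper_approx[OF L X that, of w] by auto
    show "continuous_on UNIV Y" if "Y \<in> {Y\<in>L. \<forall>w. X w \<le> Y w}" for Y
      using that sub_Cb Cb_continuous by auto
    show thesis if "\<And>n. Y n \<in> {Y\<in>L. \<forall>w. X w \<le> Y w}" "\<And>w. decseq (\<lambda>n. Y n w)"
      "\<And>w. (\<lambda>n. Y n w) \<longlonglongrightarrow> X w" for Y
      using that by (intro result[of Y]) auto
  qed (use min in auto)
qed

lemma admissible_increasing_sequence:
  fixes L :: "('a::second_countable_topology \<Rightarrow> real) set"
  assumes L: "admissible_space L" and X: "X \<in> Cb"
  obtains Y where "\<And>n::nat. Y n \<in> L" "\<And>n w. Y n w \<le> X w"
    "\<And>w. incseq (\<lambda>n. Y n w)" "\<And>w. (\<lambda>n. Y n w) \<longlonglongrightarrow> X w"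
proof -
  interpret function_lattice L by (rule admissible_imp_function_lattice[OF L])
  obtain Y where Y: "\<And>n::nat. Y n \<in> L" "\<And>n w. - X w \<le> Y n w"
    "\<And>w. decseq (\<lambda>n. Y n w)" "\<And>w. (\<lambda>n. Y n w) \<longlonglongrightarrow> - X w"
    by (rule admissible_decreasing_sequence[OF L Cb_minus[OF X]]) blast
  show ?thesis
  proof (rule that[of "\<lambda>n w. - Y n w"])
    show "(\<lambda>n. - Y n w) \<longlonglongrightarrow> X w" for w using tendsto_minus[OF Y(4)[of w]] by simp
    show "- Y n w \<le> X w" for n w using Y(2)[where w=w and n=n] by linarith
  qed (use Y minus in \<open>auto simp: incseq_def decseq_def\<close>)
qed

section \<open>A countable family of upper approximations\<close>

lemma Cb_Min:
  assumes "finite F" "F \<noteq> {}" "F \<subseteq> Cb"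
  shows "(\<lambda>w. Min ((\<lambda>b. b w) ` F)) \<in> Cb"
  using assms by (induction rule: finite_ne_induct) auto

text \<open>Truncated cones suffice, with centre in a countable dense set, rational value at the
  centre, and integral height and steepness.\<close>

lemma countable_upper_approx:
  obtains D :: "('a::{metric_space, second_countable_topology} \<Rightarrow> real) set"
  where "countable D" "D \<subseteq> Cb"
    "\<And>X e w. X \<in> Cb \<Longrightarrow> e > 0 \<Longrightarrow> \<exists>Y\<in>D. (\<forall>v. X v \<le> Y v) \<and> Y w < X w + e"
proof -
  obtain A :: "'a set" where A: "countable A" "\<And>U. open U \<Longrightarrow> U \<noteq> {} \<Longrightarrow> \<exists>a\<in>A. a \<in> U"
    by (rule countable_dense_setE) blast
  define b where "b a q N r w = q + real N * min 1 (real r * dist w a)" for a :: 'a and q N r w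
  define D where "D = (\<lambda>(a, q, N, r). b a q N r) ` (A \<times> \<rat> \<times> UNIV \<times> UNIV)"
  have "countable D" unfolding D_def using A(1) countable_rat by (intro countable_image countable_SIGMA) auto
  moreover have "b a q N r \<in> Cb" for a q N r
  proof -
    have "(\<lambda>w. min 1 (real r * dist w a)) \<in> Cb"
      by (rule CbI[where B=1]) (auto intro!: continuous_intros simp: abs_le_iff min_le_iff_disj)
    then show ?thesis unfolding b_def[abs_def] by (intro Cb_add Cb_const Cb_scale)
  qed
  then have "D \<subseteq> Cb" by (auto simp: D_def)
  moreover have "\<exists>Y\<in>D. (\<forall>v. X v \<le> Y v) \<and> Y w < X w + e" if X: "X \<in> Cb" and e: "e > 0" for X e w
  proof -
    obtain B where B: "B > 0" "\<And>w. \<bar>X w\<bar> \<le> B" using X by (metis Cb_bound)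
    have "open {v. X v < X w + e / 4}"
      using Cb_continuous[OF X] by (intro open_Collect_less) auto
    then obtain d where d: "d > 0" "\<And>v. dist v w < d \<Longrightarrow> X v < X w + e / 4"
      using e unfolding open_dist by force
    obtain q where q: "q \<in> \<rat>" "X w + e / 4 < q" "q < X w + e / 2"
      using Rats_dense_in_real[of "X w + e / 4" "X w + e / 2"] e by auto
    obtain N :: nat where N: "2 * B \<le> real N" using real_arch_simple by blast
    then have Npos: "real N > 0" using B(1) by linarith
    obtain r :: nat where r: "2 / d \<le> real r" using real_arch_simple by blast
    then have rpos: "real r > 0" using d(1) by (smt (verit) divide_pos_pos)
    \<comment> \<open>The bound d / 2 keeps the cone at full height outside the ball of radius d
      around \<open>w\<close>, since r \<ge> 2 / d, and there N \<ge> 2 B lifts it above X; the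
      second bound lets it rise by less than e / 2 at \<open>w\<close> itself.\<close>
    define s where "s = min (d / 2) (e / (2 * real N * real r))"
    have s: "s > 0" using d e Npos rpos by (simp add: s_def)
    then obtain a where a: "a \<in> A" "dist w a < s" using A(2)[of "ball w s"] by auto
    have "X v \<le> b a q N r v" for v
    proof (cases "dist v w < d")
      case True
      then show ?thesis using d(2)[OF True] q(2) by (simp add: b_def add_increasing2)
    next
      case False
      then have "d / 2 \<le> dist v a" using a(2) dist_triangle[of v w a] by (simp add: s_def dist_commute)
      then have "(2 / d) * (d / 2) \<le> real r * dist v a" using r d(1) by (intro mult_mono) auto
      then have "b a q N r v = q + real N" using d(1) by (simp add: b_def)
      then show ?thesis using q(2) N B(2)[of v] B(2)[of w] e by (simp add: abs_le_iff)
    qed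
    moreover have "b a q N r w < X w + e"
    proof -
      have "real N * min 1 (real r * dist w a) \<le> real N * (real r * dist w a)"
        by (intro mult_left_mono) auto
      also have "\<dots> < real N * (real r * (e / (2 * real N * real r)))"
        using a(2) Npos rpos by (intro mult_strict_left_mono) (auto simp: s_def)
      also have "\<dots> = e / 2" using Npos rpos by (simp add: field_simps)
      finally show ?thesis using q(3) by (simp add: b_def)
    qed
    ultimately show ?thesis using a(1) q(1) unfolding D_def
      by (intro bexI[of _ "b a q N r"] image_eqI[where x="(a, q, N, r)"]) auto
  qed
  ultimately show ?thesis by (rule that)
qed

text \<open>Closing the family under finite minima preserves countability and supplies what
  \<open>decreasing_sequence_to_infimum\<close> asks for.\<close>

lemma countable_decreasing_approx:
  obtains D :: "('a::{metric_space, second_countable_topology} \<Rightarrow> real) set"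
  where "countable D" "D \<subseteq> Cb"
    "\<And>X. X \<in> Cb \<Longrightarrow> \<exists>Y. (\<forall>n::nat. Y n \<in> D) \<and> (\<forall>n w. X w \<le> Y n w) \<and> (\<forall>w. decseq (\<lambda>n. Y n w)) \<and>
       (\<forall>w. (\<lambda>n. Y n w) \<longlonglongrightarrow> X w)"
proof -
  obtain B :: "('a \<Rightarrow> real) set" where B: "countable B" "B \<subseteq> Cb"
    "\<And>X e w. X \<in> Cb \<Longrightarrow> e > 0 \<Longrightarrow> \<exists>Y\<in>B. (\<forall>v. X v \<le> Y v) \<and> Y w < X w + e"
    by (rule countable_upper_approx) blast
  define m where "m F = (\<lambda>w. Min ((\<lambda>b. b w) ` F))" for F :: "('a \<Rightarrow> real) set"
  define D where "D = m ` {F. finite F \<and> F \<subseteq> B \<and> F \<noteq> {}}"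
  have "countable {F. finite F \<and> F \<subseteq> B \<and> F \<noteq> {}}"
    by (rule countable_subset[OF _ countable_Collect_finite_subset[OF B(1)]]) auto
  then have "countable D" unfolding D_def by (rule countable_image)
  have DCb: "D \<subseteq> Cb" using B(2) unfolding D_def m_def by (auto intro!: Cb_Min)
  have BD: "B \<subseteq> D"
  proof
    fix b assume "b \<in> B"
    moreover have "b = m {b}" by (simp add: m_def)
    ultimately show "b \<in> D" unfolding D_def by (intro image_eqI[where x="{b}"]) auto
  qed
  have Dmin: "(\<lambda>w. min (Y w) (Z w)) \<in> D" if YZ: "Y \<in> D" "Z \<in> D" for Y Z
  proof -
    obtain F G where F: "finite F" "F \<subseteq> B" "F \<noteq> {}" "Y = m F" and G: "finite G" "G \<subseteq> B" "G \<noteq> {}" "Z = m G"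
      using YZ by (auto simp: D_def)
    have "(\<lambda>w. min (Y w) (Z w)) = m (F \<union> G)"
      using F G by (simp add: m_def image_Un Min_Un fun_eq_iff)
    then show ?thesis using F G unfolding D_def by (intro image_eqI[where x="F \<union> G"]) auto
  qed
  have "\<exists>Y. (\<forall>n::nat. Y n \<in> D) \<and> (\<forall>n w. X w \<le> Y n w) \<and> (\<forall>w. decseq (\<lambda>n. Y n w)) \<and>
       (\<forall>w. (\<lambda>n. Y n w) \<longlonglongrightarrow> X w)" if X: "X \<in> Cb" for X
  proof (rule decreasing_sequence_to_infimum[of "{Y\<in>D. \<forall>w. X w \<le> Y w}" X])
    show "\<exists>Y\<in>{Y\<in>D. \<forall>w. X w \<le> Y w}. Y w < X w + e" if "e > 0" for w e
      using B(3)[OF X that, of w] BD by auto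
    show "continuous_on UNIV Y" if "Y \<in> {Y\<in>D. \<forall>w. X w \<le> Y w}" for Y
      using that DCb Cb_continuous by auto
  qed (use Dmin in auto)
  with \<open>countable D\<close> DCb that show ?thesis by blast
qed

section \<open>Uniformly regular risk measures\<close>

locale regular_risk_measure = function_lattice L
  for L :: "('a::topological_space \<Rightarrow> real) set" +
  fixes \<rho> :: "('a \<Rightarrow> real) \<Rightarrow> real"
  assumes risk: "convex_risk_measure L \<rho>" and nrm: "normalized \<rho>" and reg: "uniformly_regular L \<rho>"
begin

lemma antimono: "X \<in> L \<Longrightarrow> Y \<in> L \<Longrightarrow> (\<And>w. X w \<le> Y w) \<Longrightarrow> \<rho> Y \<le> \<rho> X"
  using risk unfolding convex_risk_measure_def by blast

lemma convex: "X \<in> L \<Longrightarrow> Y \<in> L \<Longrightarrow> 0 \<le> t \<Longrightarrow> t \<le> 1 \<Longrightarrow>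
    \<rho> (\<lambda>w. t * X w + (1 - t) * Y w) \<le> t * \<rho> X + (1 - t) * \<rho> Y"
  using risk unfolding convex_risk_measure_def by blast

lemma translate: "X \<in> L \<Longrightarrow> \<rho> (\<lambda>w. X w + a) = \<rho> X - a"
  using risk unfolding convex_risk_measure_def by blast

lemma rho_const: "\<rho> (\<lambda>_. c) = - c"
  using translate[OF const[of 0], of c] nrm by (simp add: normalized_def)

lemma bdd_above_quotients: "X \<in> L \<Longrightarrow> bdd_above {\<rho> (\<lambda>w. l * X w) / l | l::real. l > 0}"
  using reg unfolding uniformly_regular_def by (elim conjE bspec)

lemma rho_min_upper: "X \<in> L \<Longrightarrow> l > 0 \<Longrightarrow> \<rho> (\<lambda>w. l * X w) / l \<le> rho_min \<rho> X"
  unfolding rho_min_def by (intro cSup_upper bdd_above_quotients) auto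

lemma rho_min_least: "(\<And>l. l > 0 \<Longrightarrow> \<rho> (\<lambda>w. l * X w) / l \<le> b) \<Longrightarrow> rho_min \<rho> X \<le> b"
  unfolding rho_min_def by (intro cSup_least) (auto intro: exI[of _ "1::real"])

lemma rho_min_antimono:
  assumes "X \<in> L" "Y \<in> L" "\<And>w. X w \<le> Y w"
  shows "rho_min \<rho> Y \<le> rho_min \<rho> X"
proof (rule rho_min_least)
  fix l :: real assume l: "l > 0"
  then have "\<rho> (\<lambda>w. l * Y w) / l \<le> \<rho> (\<lambda>w. l * X w) / l"
    using assms by (intro divide_right_mono antimono scale) auto
  also have "\<dots> \<le> rho_min \<rho> X" using assms(1) l by (rule rho_min_upper)
  finally show "\<rho> (\<lambda>w. l * Y w) / l \<le> rho_min \<rho> X" .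
qed

lemma rho_min_const: "rho_min \<rho> (\<lambda>_. c) = - c"
  using rho_min_upper[OF const[of c], of 1] by (intro antisym rho_min_least) (auto simp: rho_const)

text \<open>X is the mixture of Y / t and (X - Y) / (1 - t) with weights t and 1 - t. After
  convexity, the second term is at most \<open>rho_min\<close> of X - Y for each t, and boundedness
  of Y gives a bound for the first that tends to \<rho> Y as t increases to 1.\<close>

lemma rho_diff_le:
  assumes X: "X \<in> L" and Y: "Y \<in> L"
  shows "\<rho> X - \<rho> Y \<le> rho_min \<rho> (\<lambda>w. X w - Y w)"
proof -
  obtain B where B: "B > 0" "\<And>w. \<bar>Y w\<bar> \<le> B" using Y sub_Cb by (metis Cb_bound subsetD)
  define r where "r = rho_min \<rho> (\<lambda>w. X w - Y w)"
  have le: "\<rho> X \<le> t * \<rho> Y + (1 - t) * B + r" if t: "0 < t" "t < 1" for t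
  proof -
    have "\<rho> (\<lambda>w. (1/t) * Y w) \<le> \<rho> (\<lambda>w. Y w + (- ((1/t - 1) * B)))"
    proof (rule antimono)
      fix w
      have "(1/t - 1) * (- B) \<le> (1/t - 1) * Y w"
        using B(2)[of w] t by (intro mult_left_mono) (auto simp: abs_le_iff)
      then show "Y w + (- ((1/t - 1) * B)) \<le> (1/t) * Y w" by (simp add: algebra_simps)
    qed (rule add[OF Y const] scale[OF Y])+
    then have "\<rho> (\<lambda>w. (1/t) * Y w) \<le> \<rho> Y + (1/t - 1) * B" 
      using translate[OF Y, of "- ((1/t - 1) * B)"] by simp
    then have "t * \<rho> (\<lambda>w. (1/t) * Y w) \<le> t * (\<rho> Y + (1/t - 1) * B)" using t by simp
    also have "\<dots> = t * \<rho> Y + (1 - t) * B" using t by (simp add: field_simps)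
    finally have 1: "t * \<rho> (\<lambda>w. (1/t) * Y w) \<le> t * \<rho> Y + (1 - t) * B" .
    have 2: "(1 - t) * \<rho> (\<lambda>w. (1/(1-t)) * (X w - Y w)) \<le> r"
      using rho_min_upper[OF diff[OF X Y], of "1/(1-t)"] t by (simp add: r_def mult.commute)
    have "X = (\<lambda>w. t * ((1/t) * Y w) + (1 - t) * ((1/(1-t)) * (X w - Y w)))"
      using t by (auto simp: fun_eq_iff)
    then have "\<rho> X \<le> t * \<rho> (\<lambda>w. (1/t) * Y w) + (1 - t) * \<rho> (\<lambda>w. (1/(1-t)) * (X w - Y w))"
      using convex[OF scale[OF Y, of "1/t"] scale[OF diff[OF X Y], of "1/(1-t)"], of t] t by simp
    with 1 2 show ?thesis by linarith
  qed
  have "((\<lambda>t. t * \<rho> Y + (1 - t) * B + r) \<longlongrightarrow> 1 * \<rho> Y + (1 - 1) * B + r) (at_left 1)"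
    by (intro tendsto_intros)
  moreover have "eventually (\<lambda>t. \<rho> X \<le> t * \<rho> Y + (1 - t) * B + r) (at_left (1::real))"
    using le by (subst eventually_at_left_field) (auto intro!: exI[of _ 0])
  ultimately have "\<rho> X \<le> 1 * \<rho> Y + (1 - 1) * B + r"
    by (intro tendsto_lowerbound) auto
  then show ?thesis by (simp add: r_def)
qed

lemma rho_min_decreasing:
  assumes Xs: "\<And>n. Xs n \<in> L" "\<And>w. decseq (\<lambda>n. Xs n w)" "\<And>w. (\<lambda>n. Xs n w) \<longlonglongrightarrow> 0"
  shows "(\<lambda>n. rho_min \<rho> (\<lambda>w. - Xs n w)) \<longlonglongrightarrow> 0"
proof (rule LIMSEQ_I)
  fix e :: real assume "e > 0"
  \<comment> \<open>Half of \<open>e\<close>, since the supremum over \<open>l\<close> turns the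
    strict bound into a weak one.\<close>
  then have "e / 2 > 0" by simp
  then obtain N where N: "\<And>n l. n \<ge> N \<Longrightarrow> l > 0 \<Longrightarrow> \<bar>\<rho> (\<lambda>w. - l * Xs n w) / l\<bar> < e / 2"
    using reg Xs unfolding uniformly_regular_def by meson
  have "\<bar>rho_min \<rho> (\<lambda>w. - Xs n w)\<bar> < e" if n: "n \<ge> N" for n
  proof -
    have "\<rho> (\<lambda>w. l * (- Xs n w)) / l \<le> e / 2" if "l > 0" for l
      using abs_le_D1[OF less_imp_le[OF N[OF n that]]] by simp
    then have "rho_min \<rho> (\<lambda>w. - Xs n w) \<le> e / 2" by (rule rho_min_least)
    moreover have "rho_min \<rho> (\<lambda>_. 0) \<le> rho_min \<rho> (\<lambda>w. - Xs n w)"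
      using Xs decseq_ge[OF Xs(2,3)] by (intro rho_min_antimono minus const) auto
    ultimately show ?thesis using rho_min_const[of 0] \<open>e > 0\<close> by simp
  qed
  then show "\<exists>N. \<forall>n\<ge>N. norm (rho_min \<rho> (\<lambda>w. - Xs n w) - 0) < e" by auto
qed

end

section \<open>Dual representation on bounded continuous functions\<close>

lemma topspace_weak_top: "topspace weak_top = borel_probs"
proof -
  have "borel_probs = {M \<in> borel_probs. (\<integral>\<omega>. (\<lambda>_. 0) \<omega> \<partial>M) \<in> UNIV}" by simp
  then have "borel_probs \<in> {{M \<in> borel_probs. (\<integral>\<omega>. f \<omega> \<partial>M) \<in> U} | f U. f \<in> Cb \<and> open U}"
    using Cb_const open_UNIV by blast
  then show ?thesis unfolding weak_top_def topspace_subtopology topology_generated_by_topspace by blast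
qed

lemma continuous_map_weak_top_integral:
  assumes "f \<in> Cb"
  shows "continuous_map weak_top euclideanreal (\<lambda>M. \<integral>w. f w \<partial>M)"
proof -
  have "openin weak_top {M \<in> borel_probs. (\<integral>w. f w \<partial>M) \<in> U}" if "open U" for U
    unfolding weak_top_def openin_subtopology
    by (rule exI[of _ "{M \<in> borel_probs. (\<integral>w. f w \<partial>M) \<in> U}"])
      (use that assms in \<open>auto intro!: topology_generated_by_Basis\<close>)
  then show ?thesis by (auto simp: continuous_map topspace_weak_top)
qed

lemma closedin_weak_top_integral:
  assumes "f \<in> Cb" "closed C"
  shows "closedin weak_top {M \<in> borel_probs. (\<integral>w. f w \<partial>M) \<in> C}"
  using closedin_continuous_map_preimage[OF continuous_map_weak_top_integral[OF assms(1)], of C] assms(2)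
  by (simp add: topspace_weak_top)

lemma penalty_attained:
  assumes X: "X \<in> Cb"
    and le: "\<And>Y. Y \<in> Cb \<Longrightarrow> (\<integral>w. - Y w \<partial>Q) - \<rho> Y \<le> (\<integral>w. - X w \<partial>Q) - \<rho> X"
  shows "penalty \<rho> Q = ereal ((\<integral>w. - X w \<partial>Q) - \<rho> X)"
  unfolding penalty_def by (rule SUP_eqI) (use X le in auto)

lemma penalty_upper:
  "Y \<in> Cb \<Longrightarrow> ereal ((\<integral>w. - Y w \<partial>Q) - \<rho> Y) \<le> penalty \<rho> Q"
  unfolding penalty_def by (rule SUP_upper)

section \<open>Functionals and measures dominated by \<open>rho_min\<close>\<close>

locale Cb_risk_measure = regular_risk_measure Cb \<rho>
  for \<rho> :: "('a::{metric_space, second_countable_topology} \<Rightarrow> real) \<Rightarrow> real"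
begin

text \<open>A predicate on arbitrary maps, so that it cuts a closed set out of a product space. The
  two bounds, exchanged when X is replaced by -X, confine each coordinate \<open>l X\<close> to a
  compact interval.\<close>

definition dominated_functional :: "(('a \<Rightarrow> real) \<Rightarrow> real) \<Rightarrow> bool" where
  "dominated_functional l \<longleftrightarrow>
     (\<forall>X\<in>Cb. \<forall>Y\<in>Cb. l (\<lambda>w. X w + Y w) = l X + l Y) \<and>
     (\<forall>X\<in>Cb. \<forall>c. l (\<lambda>w. c * X w) = c * l X) \<and>
     (\<forall>X\<in>Cb. - rho_min \<rho> X \<le> l X \<and> l X \<le> rho_min \<rho> (\<lambda>w. - X w))"

text \<open>The bounds yield the remaining Daniell axioms: X \<ge> 0 makes
  \<open>rho_min \<rho> X\<close> at most 0, whence positivity; at the constant 1 both bounds equal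
  1; and \<open>rho_min_decreasing\<close> squeezes \<open>l (Xs n)\<close> to 0.\<close>

lemma dominated_functional_representation:
  assumes "dominated_functional l"
  obtains M where "M \<in> borel_probs" "\<And>X. X \<in> Cb \<Longrightarrow> l X = (\<integral>w. X w \<partial>M)"
proof -
  have l: "\<And>X Y. X \<in> Cb \<Longrightarrow> Y \<in> Cb \<Longrightarrow> l (\<lambda>w. X w + Y w) = l X + l Y"
    "\<And>X c. X \<in> Cb \<Longrightarrow> l (\<lambda>w. c * X w) = c * l X"
    "\<And>X. X \<in> Cb \<Longrightarrow> - rho_min \<rho> X \<le> l X" "\<And>X. X \<in> Cb \<Longrightarrow> l X \<le> rho_min \<rho> (\<lambda>w. - X w)"
    using assms by (auto simp: dominated_functional_def)
  have nonneg: "0 \<le> l X" if X: "X \<in> Cb" "\<And>w. 0 \<le> X w" for X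
    using rho_min_antimono[OF const[of 0] X(1)] X(2) l(3)[OF X(1)] rho_min_const[of 0] by force
  interpret daniell_functional l
  proof
    show "l (\<lambda>_. 1) = 1"
      using l(3)[OF const[of 1]] l(4)[OF const[of 1]] rho_min_const[of 1] rho_min_const[of "-1"] by simp
    fix Xs :: "nat \<Rightarrow> 'a \<Rightarrow> real"
    assume Xs: "\<And>n. Xs n \<in> Cb" "\<And>w. decseq (\<lambda>n. Xs n w)" "\<And>w. (\<lambda>n. Xs n w) \<longlonglongrightarrow> 0"
    show "(\<lambda>n. l (Xs n)) \<longlonglongrightarrow> 0"
      using Xs l(4) decseq_ge[OF Xs(2,3)]
      by (intro tendsto_sandwich[OF _ _ tendsto_const rho_min_decreasing[OF Xs]])
         (auto intro!: always_eventually nonneg)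
  qed (use l nonneg in auto)
  show ?thesis by (rule representation) (rule that)
qed

text \<open>With -X for X this reads E_Q(-X) \<le> \<open>rho_min \<rho> X\<close> on
  \<open>Cb\<close>: these are the measures whose penalty for the sublinear \<open>rho_min\<close>
  vanishes.\<close>

definition dominated_probs :: "'a measure set" where
  "dominated_probs = {M \<in> borel_probs. \<forall>X\<in>Cb. (\<integral>w. X w \<partial>M) \<le> rho_min \<rho> (\<lambda>w. - X w)}"

lemma dominated_functional_integral:
  assumes "M \<in> dominated_probs"
  shows "dominated_functional (\<lambda>X. \<integral>w. X w \<partial>M)"
proof -
  have M: "M \<in> borel_probs" "\<And>X. X \<in> Cb \<Longrightarrow> (\<integral>w. X w \<partial>M) \<le> rho_min \<rho> (\<lambda>w. - X w)"
    using assms by (auto simp: dominated_probs_def)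
  have "- rho_min \<rho> X \<le> (\<integral>w. X w \<partial>M)" if "X \<in> Cb" for X
    using M(2)[OF minus[OF that]] by simp
  then show ?thesis
    using M by (auto simp: dominated_functional_def Cb_integrable)
qed

lemma closedin_dominated_probs: "closedin weak_top dominated_probs"
proof -
  have "dominated_probs = (\<Inter>X\<in>Cb. {M \<in> borel_probs. (\<integral>w. X w \<partial>M) \<in> {..rho_min \<rho> (\<lambda>w. - X w)}})"
    using const by (auto simp: dominated_probs_def)
  also have "closedin weak_top \<dots>"
    using const by (intro closedin_INT closedin_weak_top_integral) auto
  finally show ?thesis .
qed

text \<open>By the Daniell representation \<open>dominated_probs\<close> is a continuous image of a closed set of
  functionals in a product of compact intervals, so Tychonoff's theorem replaces tightness.\<close>

lemma compactin_dominated_probs: "compactin weak_top dominated_probs"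
proof -
  \<comment> \<open>Coordinates outside \<open>Cb\<close> are pinned to 0, so that the product over
    all functions is compact; the functional built below from a given measure follows the same
    convention.\<close>
  define I where "I X = (if X \<in> Cb then {- rho_min \<rho> X..rho_min \<rho> (\<lambda>w. - X w)} else {0})" for X
  define K where "K = Pi UNIV I \<inter> {l. dominated_functional l}"
  have "compactin (product_topology (\<lambda>_. euclideanreal) UNIV) (PiE UNIV I)"
    unfolding compactin_PiE by (auto simp: I_def)
  then have "compact (Pi UNIV I)"
    by (simp add: euclidean_product_topology PiE_UNIV_domain)
  \<comment> \<open>Each condition involves at most three coordinates, on which it is
    closed.\<close>
  moreover have "closed {l. dominated_functional l}"
    unfolding dominated_functional_def Ball_def
    by (intro closed_Collect_conj closed_Collect_all closed_Collect_imp closed_Collect_eq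
        closed_Collect_le continuous_intros) (auto intro!: continuous_intros)
  ultimately have K: "compact K" unfolding K_def by (rule compact_Int_closed)
  define T where "T l = (SOME M. M \<in> borel_probs \<and> (\<forall>X\<in>Cb. l X = (\<integral>w. X w \<partial>M)))"
    for l :: "('a \<Rightarrow> real) \<Rightarrow> real"
  have T: "T l \<in> borel_probs" "\<And>X. X \<in> Cb \<Longrightarrow> (\<integral>w. X w \<partial>T l) = l X" if "dominated_functional l" for l
  proof -
    have "\<exists>M. M \<in> borel_probs \<and> (\<forall>X\<in>Cb. l X = (\<integral>w. X w \<partial>M))"
      using dominated_functional_representation[OF that] by metis
    from someI_ex[OF this] show "T l \<in> borel_probs" "\<And>X. X \<in> Cb \<Longrightarrow> (\<integral>w. X w \<partial>T l) = l X"
      unfolding T_def by auto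
  qed
  have "continuous_map (top_of_set K) weak_top T"
    unfolding weak_top_def
  proof (intro continuous_map_into_subtopology continuous_on_generated_topo)
    fix U :: "'a measure set"
    assume "U \<in> {{M \<in> borel_probs. (\<integral>\<omega>. f \<omega> \<partial>M) \<in> V} | f V. f \<in> Cb \<and> open V}"
    then obtain f V where U: "U = {M \<in> borel_probs. (\<integral>\<omega>. f \<omega> \<partial>M) \<in> V}" "f \<in> Cb" "open V" by auto
    have "T -` U \<inter> topspace (top_of_set K) = K \<inter> (\<lambda>l. l f) -` V"
      using T U by (auto simp: K_def)
    moreover have "continuous_on K (\<lambda>l. l f)"
      by (rule continuous_on_subset[OF continuous_on_product_coordinates]) simp
    ultimately show "openin (top_of_set K) (T -` U \<inter> topspace (top_of_set K))"
      using U(3) by (simp add: continuous_openin_preimage_gen)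
  next
    have "borel_probs = topspace weak_top" by (rule topspace_weak_top[symmetric])
    also have "\<dots> \<subseteq> \<Union> {{M \<in> borel_probs. (\<integral>\<omega>. f \<omega> \<partial>M) \<in> U} | f U. f \<in> Cb \<and> open U}"
      unfolding weak_top_def topspace_subtopology topology_generated_by_topspace by blast
    finally show "T ` topspace (top_of_set K) \<subseteq> \<Union> {{M \<in> borel_probs. (\<integral>\<omega>. f \<omega> \<partial>M) \<in> U} | f U. f \<in> Cb \<and> open U}"
      using T(1) by (auto simp: K_def)
    show "T \<in> topspace (top_of_set K) \<rightarrow> borel_probs" using T(1) by (auto simp: K_def)
  qed
  then have "compactin weak_top (T ` K)"
    using K by (intro image_compactin[where X="top_of_set K"]) (auto simp: compactin_subtopology)
  moreover have "dominated_probs \<subseteq> T ` K"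
  proof
    fix M assume M: "M \<in> dominated_probs"
    define l where "l X = (if X \<in> Cb then \<integral>w. X w \<partial>M else 0)" for X
    have "dominated_functional l"
      using dominated_functional_integral[OF M] add scale unfolding dominated_functional_def l_def by simp
    moreover from this have "l \<in> Pi UNIV I"
      by (auto simp: I_def dominated_functional_def) (auto simp: l_def)
    \<comment> \<open>Measures are determined by their integrals over \<open>Cb\<close>, so the
      choice made in \<open>T\<close> returns \<open>M\<close> itself.\<close>
    moreover from calculation have "T l = M"
      using T[of l] M by (intro borel_probs_eqI) (auto simp: dominated_probs_def l_def)
    ultimately show "M \<in> T ` K" by (auto simp: K_def)
  qed
  ultimately show ?thesis using closedin_dominated_probs by (rule closed_compactin)
qed

text \<open>A subgradient d of \<rho> at X satisfies d Y \<le> \<rho> (X + Y) - \<rho> X \<le>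
  \<open>rho_min \<rho> Y\<close> by \<open>rho_diff_le\<close>, so -d is dominated and hence a
  measure; the subgradient inequality says that its penalty is attained at X. The type of bounded
  continuous functions provides the vector space for Hahn-Banach.\<close>

lemma exists_maximizer:
  assumes X: "X \<in> Cb"
  obtains Q where "Q \<in> dominated_probs" "penalty \<rho> Q = ereal ((\<integral>w. - X w \<partial>Q) - \<rho> X)"
proof -
  have ap: "apply_bcontfun x \<in> Cb" for x :: "'a \<Rightarrow>\<^sub>C real"
    using apply_bcontfun[of x] by (simp add: Cb_def bcontfun_def)
  have app: "apply_bcontfun (Bcontfun Y) = Y" if "Y \<in> Cb" for Y :: "'a \<Rightarrow> real"
    using that by (intro Bcontfun_inverse) (simp add: Cb_def bcontfun_def)
  have "convex_on UNIV (\<lambda>x. \<rho> (apply_bcontfun x))"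
  proof (rule convex_onI)
    fix t :: real and x y :: "'a \<Rightarrow>\<^sub>C real"
    assume "0 < t" "t < 1"
    then show "\<rho> (apply_bcontfun ((1 - t) *\<^sub>R x + t *\<^sub>R y)) \<le>
        (1 - t) * \<rho> (apply_bcontfun x) + t * \<rho> (apply_bcontfun y)"
      using convex[OF ap[of x] ap[of y], of "1 - t"]
      by (simp add: plus_bcontfun.rep_eq scaleR_bcontfun.rep_eq)
  qed simp
  then obtain d where d: "linear d"
    "\<And>y. \<rho> (apply_bcontfun (Bcontfun X)) + d y \<le> \<rho> (apply_bcontfun (Bcontfun X + y))"
    by (rule convex_on_subgradient) blast
  have sub: "\<rho> X + d (Bcontfun Y) \<le> \<rho> (\<lambda>w. X w + Y w)" if "Y \<in> Cb" for Y
    using d(2)[of "Bcontfun Y"] by (simp add: app X that plus_bcontfun.rep_eq)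
  \<comment> \<open>\<rho> is decreasing, so the positive functional is the negative of the
    subgradient.\<close>
  define l where "l Y = - d (Bcontfun Y)" for Y
  have add': "l (\<lambda>w. Y w + Z w) = l Y + l Z" if "Y \<in> Cb" "Z \<in> Cb" for Y Z
  proof -
    have "Bcontfun (\<lambda>w. Y w + Z w) = Bcontfun Y + Bcontfun Z"
      by (rule bcontfun_eqI) (simp add: app that add plus_bcontfun.rep_eq)
    then show ?thesis by (simp add: l_def linear_add[OF d(1)])
  qed
  have scale': "l (\<lambda>w. c * Y w) = c * l Y" if "Y \<in> Cb" for c Y
  proof -
    have "Bcontfun (\<lambda>w. c * Y w) = c *\<^sub>R Bcontfun Y"
      by (rule bcontfun_eqI) (simp add: app that scale scaleR_bcontfun.rep_eq)
    then show ?thesis by (simp add: l_def linear_scale[OF d(1)])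
  qed
  have lower: "- rho_min \<rho> Y \<le> l Y" if "Y \<in> Cb" for Y
    using sub[OF that] rho_diff_le[OF add[OF X that] X] by (simp add: l_def)
  have "l Y \<le> rho_min \<rho> (\<lambda>w. - Y w)" if "Y \<in> Cb" for Y
    using lower[OF minus[OF that]] scale'[OF that, of "-1"] by simp
  then have dom: "dominated_functional l"
    using add' scale' lower by (simp add: dominated_functional_def)
  obtain Q where Q: "Q \<in> borel_probs" "\<And>Y. Y \<in> Cb \<Longrightarrow> l Y = (\<integral>w. Y w \<partial>Q)"
    by (rule dominated_functional_representation[OF dom]) blast
  show ?thesis
  proof (rule that)
    show "Q \<in> dominated_probs"
      using Q dom by (auto simp: dominated_probs_def dominated_functional_def)
    show "penalty \<rho> Q = ereal ((\<integral>w. - X w \<partial>Q) - \<rho> X)"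
    proof (rule penalty_attained[OF X])
      fix Y :: "'a \<Rightarrow> real" assume Y: "Y \<in> Cb"
      have "l (\<lambda>w. Y w - X w) = l Y - l X"
        using add'[OF Y minus[OF X]] scale'[OF X, of "-1"] by simp
      then have "\<rho> X - (l Y - l X) \<le> \<rho> Y"
        using sub[OF diff[OF Y X]] by (simp add: l_def)
      then show "(\<integral>w. - Y w \<partial>Q) - \<rho> Y \<le> (\<integral>w. - X w \<partial>Q) - \<rho> X"
        using Q(2)[OF X] Q(2)[OF Y] by simp
    qed
  qed
qed

text \<open>Measures optimal at X up to 1 / (n + 1) form nested nonempty closed subsets of
  \<open>K\<close>; a point of their intersection is optimal.\<close>

lemma attained_in_compact:
  assumes K: "compactin weak_top K" and X: "X \<in> Cb"
    and approx: "\<And>e. e > 0 \<Longrightarrow> \<exists>Q\<in>K. \<forall>Y\<in>Cb. (\<integral>w. - Y w \<partial>Q) - \<rho> Y \<le> (\<integral>w. - X w \<partial>Q) - \<rho> X + e"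
  shows "\<exists>Q\<in>K. penalty \<rho> Q = ereal ((\<integral>w. - X w \<partial>Q) - \<rho> X)"
proof -
  have KP: "K \<subseteq> borel_probs" using compactin_subset_topspace[OF K] by (simp add: topspace_weak_top)
  \<comment> \<open>Both integrals are merged into one of X - Y, so that each inequality is a closed
    condition on a single continuous evaluation.\<close>
  define C where "C n = {Q\<in>K. \<forall>Y\<in>Cb. (\<integral>w. X w - Y w \<partial>Q) \<le> \<rho> Y - \<rho> X + 1 / real (Suc n)}" for n
  have integral_diff: "(\<integral>w. X w - Y w \<partial>Q) = (\<integral>w. - Y w \<partial>Q) - (\<integral>w. - X w \<partial>Q)" if "Q \<in> K" "Y \<in> Cb" for Q Y
    using that X KP by (simp add: Cb_integrable subset_iff)
  have "(\<Inter>n. C n) \<noteq> {}"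
  proof (rule compact_space_imp_nest)
    show "compact_space (subtopology weak_top K)" using K by (rule compact_space_subtopology)
    show "C n \<noteq> {}" for n
    proof -
      obtain Q where Q: "Q \<in> K" "\<forall>Y\<in>Cb. (\<integral>w. - Y w \<partial>Q) - \<rho> Y \<le> (\<integral>w. - X w \<partial>Q) - \<rho> X + 1 / real (Suc n)"
        using approx[of "1 / real (Suc n)"] by auto
      then have "Q \<in> C n" by (auto simp: C_def integral_diff algebra_simps)
      then show ?thesis by blast
    qed
    show "decseq C"
    proof (rule decseq_SucI)
      fix n
      have "1 / real (Suc (Suc n)) \<le> 1 / real (Suc n)" by (simp add: frac_le)
      then show "C (Suc n) \<subseteq> C n" unfolding C_def by fastforce
    qed
    show "closedin (subtopology weak_top K) (C n)" for n
    proof -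
      have "C n = K \<inter> (\<Inter>Y\<in>Cb. {M \<in> borel_probs. (\<integral>w. X w - Y w \<partial>M) \<in> {..\<rho> Y - \<rho> X + 1 / real (Suc n)}})"
        using KP by (auto simp: C_def)
      moreover have "closedin weak_top (\<Inter>Y\<in>Cb. {M \<in> borel_probs. (\<integral>w. X w - Y w \<partial>M) \<in> {..\<rho> Y - \<rho> X + 1 / real (Suc n)}})"
        using X by (intro closedin_INT closedin_weak_top_integral) (auto intro: diff const)
      ultimately show ?thesis by (simp add: closedin_subtopology_Int_closed)
    qed
  qed
  then obtain Q where Q: "\<And>n. Q \<in> C n" by auto
  then have QK: "Q \<in> K" by (auto simp: C_def)
  have "penalty \<rho> Q = ereal ((\<integral>w. - X w \<partial>Q) - \<rho> X)"
  proof (rule penalty_attained[OF X])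
    fix Y :: "'a \<Rightarrow> real" assume Y: "Y \<in> Cb"
    have "(\<integral>w. X w - Y w \<partial>Q) \<le> \<rho> Y - \<rho> X + 1 / real (Suc n)" for n
      using Q[of n] Y by (auto simp: C_def)
    moreover have "(\<lambda>n. \<rho> Y - \<rho> X + 1 / real (Suc n)) \<longlonglongrightarrow> \<rho> Y - \<rho> X + 0"
      by (intro tendsto_add tendsto_const LIMSEQ_Suc[OF lim_1_over_n])
    ultimately have "(\<integral>w. X w - Y w \<partial>Q) \<le> \<rho> Y - \<rho> X + 0"
      by (intro LIMSEQ_le_const) auto
    then show "(\<integral>w. - Y w \<partial>Q) - \<rho> Y \<le> (\<integral>w. - X w \<partial>Q) - \<rho> X"
      using integral_diff[OF QK Y] by simp
  qed
  with QK show ?thesis by blast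
qed

text \<open>A measure exact at Z \<ge> X contributes at least \<rho> Z to the supremum for X, since
  E_Q(-Z) \<le> E_Q(-X). The loss \<rho> X - \<rho> Z is at most \<open>rho_min\<close> of X - Z,
  which tends to 0 as Z decreases to X.\<close>

lemma countable_representation:
  obtains Q :: "nat \<Rightarrow> 'a measure"
  where "\<And>n. Q n \<in> dominated_probs" "\<And>n. \<bar>penalty \<rho> (Q n)\<bar> \<noteq> \<infinity>"
    "\<And>X. X \<in> Cb \<Longrightarrow> ereal (\<rho> X) = (SUP n. ereal (\<integral>w. - X w \<partial>Q n) - penalty \<rho> (Q n))"
proof -
  obtain D :: "('a \<Rightarrow> real) set" where D: "countable D" "D \<subseteq> Cb"
    "\<And>X. X \<in> Cb \<Longrightarrow> \<exists>Y. (\<forall>n::nat. Y n \<in> D) \<and> (\<forall>n w. X w \<le> Y n w) \<and> (\<forall>w. decseq (\<lambda>n. Y n w)) \<and>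
       (\<forall>w. (\<lambda>n. Y n w) \<longlonglongrightarrow> X w)"
    by (rule countable_decreasing_approx) blast
  have "D \<noteq> {}" using D(3)[OF const[of 0]] by blast
  define Y where "Y = from_nat_into D"
  have YD: "Y n \<in> D" and Y: "Y n \<in> Cb" for n
    unfolding Y_def using from_nat_into[OF \<open>D \<noteq> {}\<close>] D(2) by auto
  have "\<exists>Q. Q \<in> dominated_probs \<and> penalty \<rho> Q = ereal ((\<integral>w. - Y n w \<partial>Q) - \<rho> (Y n))" for n
    by (rule exists_maximizer[OF Y[of n]]) blast
  then obtain Q where Q: "\<And>n. Q n \<in> dominated_probs"
    "\<And>n. penalty \<rho> (Q n) = ereal ((\<integral>w. - Y n w \<partial>Q n) - \<rho> (Y n))" by metis
  have "ereal (\<rho> X) = (SUP n. ereal (\<integral>w. - X w \<partial>Q n) - penalty \<rho> (Q n))" if X: "X \<in> Cb" for X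
  proof (rule SUP_eqI[symmetric])
    fix n
    show "ereal (\<integral>w. - X w \<partial>Q n) - penalty \<rho> (Q n) \<le> ereal (\<rho> X)"
      using penalty_upper[OF X, of "Q n" \<rho>] Q(2)[of n] by simp
  next
    fix b assume b: "\<And>n. n \<in> UNIV \<Longrightarrow> ereal (\<integral>w. - X w \<partial>Q n) - penalty \<rho> (Q n) \<le> b"
    obtain Z where Z: "\<And>n::nat. Z n \<in> D" "\<And>n w. X w \<le> Z n w" "\<And>w. decseq (\<lambda>n. Z n w)"
      "\<And>w. (\<lambda>n. Z n w) \<longlonglongrightarrow> X w" using D(3)[OF X] by blast
    have ZCb: "Z n \<in> Cb" for n using Z(1) D(2) by blast
    have "ereal (\<rho> (Z n)) \<le> b" for n
    proof -
      obtain m where m: "Z n = Y m"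
        using Z(1)[of n] D(1) unfolding Y_def by (metis from_nat_into_surj)
      have "Q m \<in> borel_probs" using Q(1) by (auto simp: dominated_probs_def)
      then have "(\<integral>w. - Z n w \<partial>Q m) \<le> (\<integral>w. - X w \<partial>Q m)"
        using X ZCb Z(2) by (intro integral_mono Cb_integrable minus) auto
      then have "ereal (\<rho> (Z n)) \<le> ereal (\<integral>w. - X w \<partial>Q m) - penalty \<rho> (Q m)"
        unfolding Q(2) m by simp
      also have "\<dots> \<le> b" using b by simp
      finally show ?thesis .
    qed
    moreover have "(\<lambda>n. \<rho> X - rho_min \<rho> (\<lambda>w. - (Z n w - X w))) \<longlonglongrightarrow> \<rho> X - 0"
    proof (intro tendsto_diff tendsto_const rho_min_decreasing)
      show "(\<lambda>n. Z n w - X w) \<longlonglongrightarrow> 0" for w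
        using tendsto_diff[OF Z(4) tendsto_const, of w "X w"] by simp
    qed (use Z X ZCb in \<open>auto intro: diff simp: decseq_def\<close>)
    then have "(\<lambda>n. ereal (\<rho> X - rho_min \<rho> (\<lambda>w. - (Z n w - X w)))) \<longlonglongrightarrow> ereal (\<rho> X - 0)"
      by (rule tendsto_ereal)
    moreover have "ereal (\<rho> X - rho_min \<rho> (\<lambda>w. - (Z n w - X w))) \<le> ereal (\<rho> (Z n))" for n
      using rho_diff_le[OF X ZCb[of n]] by simp
    ultimately have "ereal (\<rho> X - 0) \<le> b"
      by (intro LIMSEQ_le_const2) (blast intro: order_trans)+
    then show "ereal (\<rho> X) \<le> b" by simp
  qed
  with Q that[of Q] show ?thesis by simp
qed

lemma closure_attains:
  assumes Q: "\<And>n. Q n \<in> dominated_probs" "\<And>n. \<bar>penalty \<rho> (Q n)\<bar> \<noteq> \<infinity>"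
    and rep: "\<And>X. X \<in> Cb \<Longrightarrow> ereal (\<rho> X) = (SUP n. ereal (\<integral>w. - X w \<partial>Q n) - penalty \<rho> (Q n))"
  shows "compactin weak_top (weak_top closure_of (range Q))"
    and "X \<in> Cb \<Longrightarrow> \<exists>QX \<in> weak_top closure_of (range Q). ereal (\<rho> X) = ereal (\<integral>w. - X w \<partial>QX) - penalty \<rho> QX"
proof -
  have "range Q \<subseteq> dominated_probs" using Q(1) by auto
  then show K: "compactin weak_top (weak_top closure_of (range Q))"
    by (intro closed_compactin[OF compactin_dominated_probs] closure_of_minimal closedin_dominated_probs) auto
  have QK: "Q n \<in> weak_top closure_of (range Q)" for n
    using closure_of_subset[of "range Q" weak_top] Q(1) by (auto simp: topspace_weak_top dominated_probs_def)
  assume X: "X \<in> Cb"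
  have "\<exists>R\<in>weak_top closure_of (range Q). penalty \<rho> R = ereal ((\<integral>w. - X w \<partial>R) - \<rho> X)"
  proof (rule attained_in_compact[OF K X])
    fix e :: real assume "e > 0"
    then have "ereal (\<rho> X - e) < (SUP n. ereal (\<integral>w. - X w \<partial>Q n) - penalty \<rho> (Q n))"
      using rep[OF X] by (metis diff_less_eq ereal_less(1) less_add_same_cancel1 less_ereal.simps(1))
    then obtain n where n: "ereal (\<rho> X - e) < ereal (\<integral>w. - X w \<partial>Q n) - penalty \<rho> (Q n)"
      by (auto simp: less_SUP_iff)
    obtain p where p: "penalty \<rho> (Q n) = ereal p" using Q(2)[of n] by (cases "penalty \<rho> (Q n)") auto
    \<comment> \<open>Closeness to the supremum, with the penalty unfolded over Y, is the
      near-optimality that \<open>attained_in_compact\<close> requires.\<close>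
    have "(\<integral>w. - Y w \<partial>Q n) - \<rho> Y \<le> (\<integral>w. - X w \<partial>Q n) - \<rho> X + e" if "Y \<in> Cb" for Y
      using penalty_upper[OF that, of "Q n" \<rho>] n p by simp
    then show "\<exists>R\<in>weak_top closure_of (range Q). \<forall>Y\<in>Cb. (\<integral>w. - Y w \<partial>R) - \<rho> Y \<le> (\<integral>w. - X w \<partial>R) - \<rho> X + e"
      using QK by blast
  qed
  then show "\<exists>QX \<in> weak_top closure_of (range Q). ereal (\<rho> X) = ereal (\<integral>w. - X w \<partial>QX) - penalty \<rho> QX"
    by force
qed

text \<open>If \<rho> vanishes on the ray through X, then l E(-X) is at most the penalty of
  \<open>Q n\<close> for every l > 0, which its finiteness allows only for E(-X) = 0. Conversely,
  zero integrals make the representations of l X and of 0 agree term by term.\<close>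

lemma riskless_iff:
  assumes Q: "\<And>n. \<bar>penalty \<rho> (Q n)\<bar> \<noteq> \<infinity>"
    and rep: "\<And>X. X \<in> Cb \<Longrightarrow> ereal (\<rho> X) = (SUP n. ereal (\<integral>w. - X w \<partial>Q n) - penalty \<rho> (Q n))"
    and X: "X \<in> Cb" "\<And>w. X w \<le> 0"
  shows "riskless \<rho> X \<longleftrightarrow> (\<forall>n. (\<integral>w. X w \<partial>Q n) = 0)"
proof
  assume R: "riskless \<rho> X"
  show "\<forall>n. (\<integral>w. X w \<partial>Q n) = 0"
  proof
    fix n
    obtain p where p: "penalty \<rho> (Q n) = ereal p" using Q[of n] by (cases "penalty \<rho> (Q n)") auto
    define c where "c = (\<integral>w. - X w \<partial>Q n)"
    have le: "l * c \<le> p" if "l > 0" for l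
      using penalty_upper[OF scale[OF X(1), of l], of "Q n" \<rho>] R that p by (simp add: riskless_def c_def)
    have "\<not> 0 < c"
    proof
      assume "0 < c"
      then show False using le[of "(\<bar>p\<bar> + 1) / c"] by simp
    qed
    moreover have "0 \<le> c"
      unfolding c_def using X(2) by (intro Bochner_Integration.integral_nonneg) auto
    ultimately show "(\<integral>w. X w \<partial>Q n) = 0" by (simp add: c_def)
  qed
next
  assume zero: "\<forall>n. (\<integral>w. X w \<partial>Q n) = 0"
  show "riskless \<rho> X"
    unfolding riskless_def
  proof (intro allI impI)
    fix l :: real assume "l > 0"
    have "ereal (\<rho> (\<lambda>w. l * X w)) = (SUP n. ereal 0 - penalty \<rho> (Q n))"
      using rep[OF scale[OF X(1)], of l] zero by simp
    also have "\<dots> = ereal (\<rho> (\<lambda>_. 0))" using rep[OF const[of 0]] by simp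
    finally show "\<rho> (\<lambda>w. l * X w) = 0" by (simp add: rho_const)
  qed
qed

end

lemma AE_countable_mixture:
  assumes Q: "\<And>n::nat. sets (Q n) = sets borel" and P: "sets P = sets borel"
    and a: "\<And>n. a n > 0"
    and mix: "\<And>A. A \<in> sets borel \<Longrightarrow> emeasure P A = (\<Sum>n. ennreal (a n) * emeasure (Q n) A)"
    and A: "{w. \<not> R w} \<in> sets borel"
  shows "(AE w in P. R w) \<longleftrightarrow> (\<forall>n. AE w in Q n. R w)"
proof -
  have sp: "space (Q n) = UNIV" "space P = UNIV" for n
    using Q[of n] P by (metis sets_eq_imp_space_eq space_borel)+
  have "(AE w in P. R w) \<longleftrightarrow> emeasure P {w. \<not> R w} = 0"
    using A P by (subst AE_iff_measurable[OF _ refl]) (auto simp: sp)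
  also have "\<dots> \<longleftrightarrow> (\<forall>n. emeasure (Q n) {w. \<not> R w} = 0)"
    using a by (simp add: mix[OF A] suminf_eq_zero_iff ennreal_eq_0_iff linorder_not_less[symmetric])
  also have "\<dots> \<longleftrightarrow> (\<forall>n. AE w in Q n. R w)"
    using A Q by (subst AE_iff_measurable[OF _ refl]) (auto simp: sp)
  finally show ?thesis .
qed

section \<open>The extension\<close>

locale admissible_risk_measure = regular_risk_measure L \<rho>
  for L :: "('a::{metric_space, second_countable_topology} \<Rightarrow> real) set" and \<rho> +
  assumes admissible: "admissible_space L"
begin

text \<open>As \<rho> is decreasing, minorants of X bound its risk from above. The supremum over
  majorants in \<open>L\<close> gives the same value, because the gap in \<open>sandwich\<close>
  vanishes. An infimum spares the check that a limit does not depend on the sequence.\<close>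

definition extension :: "('a \<Rightarrow> real) \<Rightarrow> real" where
  "extension X = Inf {\<rho> Y | Y. Y \<in> L \<and> (\<forall>w. Y w \<le> X w)}"

lemma extension_le:
  assumes "X \<in> Cb" "Y \<in> L" "\<And>w. Y w \<le> X w"
  shows "extension X \<le> \<rho> Y"
proof -
  obtain B where B: "B > 0" "\<And>w. \<bar>X w\<bar> \<le> B" using assms(1) by (metis Cb_bound)
  have "- B \<le> \<rho> Z" if "Z \<in> L" "\<And>w. Z w \<le> X w" for Z
  proof -
    have "Z w \<le> B" for w using that(2)[of w] B(2)[of w] by linarith
    then show ?thesis using antimono[OF that(1) const[of B]] rho_const[of B] by simp
  qed
  then have "bdd_below {\<rho> Y | Y. Y \<in> L \<and> (\<forall>w. Y w \<le> X w)}" by (intro bdd_belowI[of _ "- B"]) auto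
  then show ?thesis unfolding extension_def using assms by (intro cInf_lower) auto
qed

lemma le_extension:
  assumes "X \<in> Cb" "Y \<in> L" "\<And>w. X w \<le> Y w"
  shows "\<rho> Y \<le> extension X"
  unfolding extension_def
proof (rule cInf_greatest)
  obtain B where B: "B > 0" "\<And>w. \<bar>X w\<bar> \<le> B" using assms(1) by (metis Cb_bound)
  then have "- B \<le> X w" for w by (metis abs_le_D2 minus_le_iff)
  then show "{\<rho> Y | Y. Y \<in> L \<and> (\<forall>w. Y w \<le> X w)} \<noteq> {}" using const[of "- B"] by blast
qed (use assms in \<open>auto intro!: antimono intro: order_trans\<close>)

lemma extension_eq: "X \<in> L \<Longrightarrow> extension X = \<rho> X"
  using sub_Cb by (intro antisym extension_le le_extension) auto

lemma extension_antimono: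
  assumes "X \<in> Cb" "Y \<in> Cb" "\<And>w. X w \<le> Y w"
  shows "extension Y \<le> extension X"
  unfolding extension_def[of X]
proof (rule cInf_greatest)
  obtain B where B: "B > 0" "\<And>w. \<bar>X w\<bar> \<le> B" using assms(1) by (metis Cb_bound)
  then have "- B \<le> X w" for w by (metis abs_le_D2 minus_le_iff)
  then show "{\<rho> Y | Y. Y \<in> L \<and> (\<forall>w. Y w \<le> X w)} \<noteq> {}" using const[of "- B"] by blast
  fix r assume "r \<in> {\<rho> Z | Z. Z \<in> L \<and> (\<forall>w. Z w \<le> X w)}"
  then obtain Z where "r = \<rho> Z" "Z \<in> L" "\<And>w. Z w \<le> X w" by auto
  then show "extension Y \<le> r" using assms by (auto intro!: extension_le intro: order_trans)
qed

lemma sandwich: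
  assumes X: "X \<in> Cb"
  obtains Y Z where "\<And>n::nat. Y n \<in> L" "\<And>n w. X w \<le> Y n w" "\<And>n. Z n \<in> L" "\<And>n w. Z n w \<le> X w"
    "(\<lambda>n. rho_min \<rho> (\<lambda>w. - (Y n w - Z n w))) \<longlonglongrightarrow> 0"
proof -
  obtain Y where Y: "\<And>n::nat. Y n \<in> L" "\<And>n w. X w \<le> Y n w"
    "\<And>w. decseq (\<lambda>n. Y n w)" "\<And>w. (\<lambda>n. Y n w) \<longlonglongrightarrow> X w"
    by (rule admissible_decreasing_sequence[OF admissible X]) blast
  obtain Z where Z: "\<And>n::nat. Z n \<in> L" "\<And>n w. Z n w \<le> X w"
    "\<And>w. incseq (\<lambda>n. Z n w)" "\<And>w. (\<lambda>n. Z n w) \<longlonglongrightarrow> X w"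
    by (rule admissible_increasing_sequence[OF admissible X]) blast
  have "(\<lambda>n. rho_min \<rho> (\<lambda>w. - (Y n w - Z n w))) \<longlonglongrightarrow> 0"
  proof (rule rho_min_decreasing)
    show "(\<lambda>n. Y n w - Z n w) \<longlonglongrightarrow> 0" for w
      using tendsto_diff[OF Y(4)[of w] Z(4)[of w]] by simp
    show "decseq (\<lambda>n. Y n w - Z n w)" for w
      using Y(3)[of w] Z(3)[of w] by (auto simp: decseq_def incseq_def intro!: diff_mono)
  qed (use Y Z diff in auto)
  with Y Z that show ?thesis by blast
qed

text \<open>Turns the infimum into a limit, through which the inequalities for \<rho> on
  \<open>L\<close> pass to \<open>Cb\<close>.\<close>

lemma lower_approx:
  assumes X: "X \<in> Cb"
  obtains Z where "\<And>n::nat. Z n \<in> L" "\<And>n w. Z n w \<le> X w" "(\<lambda>n. \<rho> (Z n)) \<longlonglongrightarrow> extension X"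
proof -
  obtain Y Z where YZ: "\<And>n::nat. Y n \<in> L" "\<And>n w. X w \<le> Y n w" "\<And>n. Z n \<in> L" "\<And>n w. Z n w \<le> X w"
    "(\<lambda>n. rho_min \<rho> (\<lambda>w. - (Y n w - Z n w))) \<longlonglongrightarrow> 0"
    by (rule sandwich[OF X]) blast
  have "(\<lambda>n. \<rho> (Z n)) \<longlonglongrightarrow> extension X"
  proof (rule tendsto_sandwich)
    show "\<forall>\<^sub>F n in sequentially. extension X \<le> \<rho> (Z n)"
      using YZ X by (auto intro!: always_eventually extension_le)
    have "\<rho> (Z n) \<le> extension X + rho_min \<rho> (\<lambda>w. - (Y n w - Z n w))" for n
      using rho_diff_le[OF YZ(3,1), of n n] le_extension[OF X YZ(1,2), of n] by simp
    then show "\<forall>\<^sub>F n in sequentially. \<rho> (Z n) \<le> extension X + rho_min \<rho> (\<lambda>w. - (Y n w - Z n w))"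
      by simp
    show "(\<lambda>n. extension X + rho_min \<rho> (\<lambda>w. - (Y n w - Z n w))) \<longlonglongrightarrow> extension X"
      using tendsto_add[OF tendsto_const YZ(5), of "extension X"] by simp
  qed simp
  with YZ that show ?thesis by blast
qed

lemma convex_risk_measure_extension: "convex_risk_measure Cb extension"
  unfolding convex_risk_measure_def
proof (intro conjI ballI allI impI)
  fix X Y :: "'a \<Rightarrow> real" and t :: real
  assume X: "X \<in> Cb" and Y: "Y \<in> Cb"
  show "extension Y \<le> extension X" if "\<forall>w. X w \<le> Y w"
    using X Y that by (intro extension_antimono) auto
  assume t: "0 \<le> t \<and> t \<le> 1"
  obtain U where U: "\<And>n::nat. U n \<in> L" "\<And>n w. U n w \<le> X w" "(\<lambda>n. \<rho> (U n)) \<longlonglongrightarrow> extension X"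
    by (rule lower_approx[OF X]) blast
  obtain V where V: "\<And>n::nat. V n \<in> L" "\<And>n w. V n w \<le> Y w" "(\<lambda>n. \<rho> (V n)) \<longlonglongrightarrow> extension Y"
    by (rule lower_approx[OF Y]) blast
  have "extension (\<lambda>w. t * X w + (1 - t) * Y w) \<le> t * \<rho> (U n) + (1 - t) * \<rho> (V n)" for n
  proof -
    have "extension (\<lambda>w. t * X w + (1 - t) * Y w) \<le> \<rho> (\<lambda>w. t * U n w + (1 - t) * V n w)"
    proof (rule extension_le)
      show "t * U n w + (1 - t) * V n w \<le> t * X w + (1 - t) * Y w" for w
        using U(2) V(2) t by (intro add_mono mult_left_mono) auto
    qed (intro Cb_add Cb_scale X Y add scale U(1) V(1))+
    also have "\<dots> \<le> t * \<rho> (U n) + (1 - t) * \<rho> (V n)" using U(1) V(1) t by (intro convex) auto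
    finally show ?thesis .
  qed
  then show "extension (\<lambda>w. t * X w + (1 - t) * Y w) \<le> t * extension X + (1 - t) * extension Y"
    by (intro LIMSEQ_le_const[OF tendsto_add[OF tendsto_mult_left[OF U(3)] tendsto_mult_left[OF V(3)]]]) auto
next
  \<comment> \<open>One inequality is enough: applied to X + a and -a it yields the reverse
    one.\<close>
  have le: "extension (\<lambda>w. X w + a) \<le> extension X - a" if X: "X \<in> Cb" for X a
  proof -
    obtain U where U: "\<And>n::nat. U n \<in> L" "\<And>n w. U n w \<le> X w" "(\<lambda>n. \<rho> (U n)) \<longlonglongrightarrow> extension X"
      by (rule lower_approx[OF X]) blast
    have "extension (\<lambda>w. X w + a) \<le> \<rho> (U n) - a" for n
      using extension_le[of "\<lambda>w. X w + a" "\<lambda>w. U n w + a"] X U(1,2) translate[OF U(1)[of n], of a]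
        add[OF U(1)[of n] const[of a]] by (simp add: Cb_add)
    then show ?thesis
      by (intro LIMSEQ_le_const[OF tendsto_diff[OF U(3) tendsto_const]]) auto
  qed
  fix X :: "'a \<Rightarrow> real" and a :: real
  assume X: "X \<in> Cb"
  have "extension (\<lambda>w. (X w + a) + - a) \<le> extension (\<lambda>w. X w + a) - - a"
    using X by (intro le) auto
  then show "extension (\<lambda>w. X w + a) = extension X - a" using le[OF X, of a] by simp
qed

lemma normalized_extension: "normalized extension"
  using extension_eq[OF const[of 0]] nrm by (simp add: normalized_def)

text \<open>The given sequence need not lie in \<open>L\<close>. The majorants in \<open>L\<close>
  of any of its members are stable under minima because the sequence decreases, and their infimum is
  0. A sequence in \<open>L\<close> thus decreases to 0 through such majorants, and regularity of
  \<rho> along it controls all later members of the given one.\<close>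

lemma uniformly_regular_extension: "uniformly_regular Cb extension"
  unfolding uniformly_regular_def
proof (intro conjI ballI allI impI)
  fix X :: "'a \<Rightarrow> real" assume X: "X \<in> Cb"
  then obtain B where B: "B > 0" "\<And>w. \<bar>X w\<bar> \<le> B" by (metis Cb_bound)
  have "extension (\<lambda>w. l * X w) / l \<le> B" if l: "l > 0" for l
  proof -
    have "l * (- B) \<le> l * X w" for w
      using B(2)[of w] l by (intro mult_left_mono) (auto simp: abs_le_iff)
    then have "extension (\<lambda>w. l * X w) \<le> \<rho> (\<lambda>_. l * (- B))"
      using X by (intro extension_le const) auto
    then show ?thesis using l by (simp add: rho_const pos_divide_le_eq mult.commute)
  qed
  then show "bdd_above {extension (\<lambda>w. l * X w) / l | l::real. l > 0}"
    by (intro bdd_aboveI[of _ B]) auto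
next
  fix Xs :: "nat \<Rightarrow> 'a \<Rightarrow> real" and e :: real
  assume e: "e > 0" and
    "(\<forall>n. Xs n \<in> Cb) \<and> (\<forall>w. decseq (\<lambda>n. Xs n w) \<and> (\<lambda>n. Xs n w) \<longlonglongrightarrow> 0)"
  then have Xs: "\<And>n. Xs n \<in> Cb" and dec: "\<And>w. decseq (\<lambda>n. Xs n w)"
    and lim: "\<And>w. (\<lambda>n. Xs n w) \<longlonglongrightarrow> 0" by auto
  have nn: "0 \<le> Xs n w" for n w by (rule decseq_ge[OF dec lim])
  define S where "S = {Y \<in> L. \<exists>i. \<forall>w. Xs i w \<le> Y w}"
  obtain W where W: "\<And>n::nat. W n \<in> S" "\<And>w. decseq (\<lambda>n. W n w)" "\<And>w. (\<lambda>n. W n w) \<longlonglongrightarrow> 0"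
  proof (rule decreasing_sequence_to_infimum[of S "\<lambda>_. 0"])
    show "continuous_on UNIV Y" if "Y \<in> S" for Y
      using that sub_Cb Cb_continuous by (auto simp: S_def)
    show "0 \<le> Y w" if "Y \<in> S" for Y w
      using that nn by (auto simp: S_def intro: order_trans)
    show "(\<lambda>w. min (Y w) (Z w)) \<in> S" if YZ: "Y \<in> S" "Z \<in> S" for Y Z
    proof -
      obtain i j where "\<forall>w. Xs i w \<le> Y w" "\<forall>w. Xs j w \<le> Z w" using YZ by (auto simp: S_def)
      moreover have "Xs (max i j) w \<le> Xs i w" "Xs (max i j) w \<le> Xs j w" for w
        using dec by (auto simp: decseq_def)
      ultimately have "\<forall>w. Xs (max i j) w \<le> min (Y w) (Z w)" by (meson min.boundedI order_trans)
      then show ?thesis using YZ min by (auto simp: S_def)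
    qed
    show "\<exists>Y\<in>S. Y w < 0 + d" if "d > 0" for w and d :: real
    proof -
      have "\<forall>\<^sub>F n in sequentially. Xs n w < d" using lim that by (rule order_tendstoD)
      then obtain i where "Xs i w < d" by (auto simp: eventually_sequentially)
      then obtain Y where "Y \<in> L" "\<forall>v. Xs i v \<le> Y v" "Y w < Xs i w + (d - Xs i w)"
        using admissible_upper_approx[OF admissible, of "Xs i" "d - Xs i w" w] Xs by auto
      then show ?thesis by (intro bexI[of _ Y]) (auto simp: S_def)
    qed
  qed blast
  have WL: "W n \<in> L" for n using W(1) by (simp add: S_def)
  obtain N where N: "\<And>n l. n \<ge> N \<Longrightarrow> l > 0 \<Longrightarrow> \<bar>\<rho> (\<lambda>w. - l * W n w) / l\<bar> < e"
    using reg W(2,3) WL e unfolding uniformly_regular_def by meson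
  obtain m where m: "\<And>w. Xs m w \<le> W N w" using W(1)[of N] by (auto simp: S_def)
  show "\<exists>N. \<forall>n\<ge>N. \<forall>l::real>0. \<bar>extension (\<lambda>w. - l * Xs n w) / l\<bar> < e"
  proof (intro exI allI impI)
    fix n and l :: real assume n: "m \<le> n" and l: "l > 0"
    have XW: "Xs n w \<le> W N w" for w
      using decseqD[OF dec n, of w] m[of w] by (rule order_trans)
    have cb: "(\<lambda>w. - l * Xs n w) \<in> Cb" by (rule Cb_scale[OF Xs])
    have "extension (\<lambda>_. 0) \<le> extension (\<lambda>w. - l * Xs n w)"
      using nn l by (intro extension_antimono cb) auto
    then have 1: "0 \<le> extension (\<lambda>w. - l * Xs n w)"
      by (simp add: extension_eq const rho_const)
    have "extension (\<lambda>w. - l * Xs n w) \<le> \<rho> (\<lambda>w. - l * W N w)"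
      using XW l by (intro extension_le cb scale WL) auto
    then have "extension (\<lambda>w. - l * Xs n w) / l \<le> \<rho> (\<lambda>w. - l * W N w) / l"
      using l by (intro divide_right_mono) auto
    also have "\<dots> < e" using abs_ge_self N[OF order_refl l] by (rule le_less_trans)
    finally show "\<bar>extension (\<lambda>w. - l * Xs n w) / l\<bar> < e"
      using 1 l by (simp only: abs_of_nonneg divide_nonneg_pos)
  qed
qed

sublocale ext: Cb_risk_measure extension
  using function_lattice_Cb convex_risk_measure_extension normalized_extension uniformly_regular_extension
  by (simp add: Cb_risk_measure_def regular_risk_measure_def regular_risk_measure_axioms_def)

section \<open>Continuity for the capacity and uniqueness\<close>

lemma cap_set_nonempty: "X \<in> Cb \<Longrightarrow> {c_rho \<rho> Y | Y. Y \<in> L \<and> (\<forall>w. \<bar>X w\<bar> \<le> Y w)} \<noteq> {}"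
  using const by (elim Cb_bound) blast

text \<open>Any Z in \<open>L\<close> above |X - Y| satisfies -Z \<le> X - Y and -Z \<le> Y - X, so
  its capacity bounds \<open>rho_min\<close> of both differences, and \<open>rho_diff_le\<close> for
  the extension applies.\<close>

lemma extension_diff_le_cap:
  assumes X: "X \<in> Cb" and Y: "Y \<in> Cb"
  shows "\<bar>extension X - extension Y\<bar> \<le> cap L \<rho> (\<lambda>w. X w - Y w)"
  unfolding cap_def
proof (rule cInf_greatest)
  show "{c_rho \<rho> Z | Z. Z \<in> L \<and> (\<forall>w. \<bar>X w - Y w\<bar> \<le> Z w)} \<noteq> {}"
    using X Y by (intro cap_set_nonempty) auto
  fix c assume "c \<in> {c_rho \<rho> Z | Z. Z \<in> L \<and> (\<forall>w. \<bar>X w - Y w\<bar> \<le> Z w)}"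
  then obtain Z where Z: "c = c_rho \<rho> Z" "Z \<in> L" "\<And>w. \<bar>X w - Y w\<bar> \<le> Z w" by auto
  have "c = rho_min \<rho> (\<lambda>w. - Z w)"
    using Z(3) unfolding Z(1) c_rho_def by (metis abs_ge_zero abs_of_nonneg order_trans)
  \<comment> \<open>The extension agrees with \<rho> on every multiple of \<open>Z\<close>.\<close>
  also have "\<dots> = rho_min extension (\<lambda>w. - Z w)"
    unfolding rho_min_def using Z(2) by (simp add: extension_eq scale minus)
  finally have c: "c = rho_min extension (\<lambda>w. - Z w)" .
  have ZCb: "Z \<in> Cb" using Z(2) sub_Cb by blast
  have "- Z w \<le> X w - Y w" "- Z w \<le> Y w - X w" for w using Z(3)[of w] by (auto simp: abs_le_iff)
  then have "rho_min extension (\<lambda>w. X w - Y w) \<le> c" "rho_min extension (\<lambda>w. Y w - X w) \<le> c"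
    unfolding c using X Y ZCb by (auto intro!: ext.rho_min_antimono)
  then show "\<bar>extension X - extension Y\<bar> \<le> c"
    using ext.rho_diff_le[OF X Y] ext.rho_diff_le[OF Y X] by linarith
qed

lemma cap_continuous_extension_extension: "cap_continuous_extension L \<rho> extension"
  unfolding cap_continuous_extension_def
proof (intro conjI ballI allI impI)
  fix X and Xs :: "nat \<Rightarrow> 'a \<Rightarrow> real"
  assume X: "X \<in> Cb" and Xs: "(\<forall>n. Xs n \<in> Cb) \<and> (\<lambda>n. cap L \<rho> (\<lambda>w. Xs n w - X w)) \<longlonglongrightarrow> 0"
  have "(\<lambda>n. extension (Xs n) - extension X) \<longlonglongrightarrow> 0"
    by (rule Lim_null_comparison[OF _ conjunct2[OF Xs]])
       (use Xs X in \<open>auto intro!: always_eventually extension_diff_le_cap\<close>)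
  then show "(\<lambda>n. extension (Xs n)) \<longlonglongrightarrow> extension X" by (simp add: LIM_zero_iff)
qed (rule extension_eq)

text \<open>\<open>L\<close> is dense in \<open>Cb\<close> for the capacity: |Y n - X| \<le> Y n - Z
  n, and the capacity of the right side tends to 0. Continuity then leaves one possible value at
  X.\<close>

lemma extension_unique:
  assumes \<sigma>: "cap_continuous_extension L \<rho> \<sigma>" and X: "X \<in> Cb"
  shows "\<sigma> X = extension X"
proof -
  obtain Y Z where YZ: "\<And>n::nat. Y n \<in> L" "\<And>n w. X w \<le> Y n w" "\<And>n. Z n \<in> L" "\<And>n w. Z n w \<le> X w"
    "(\<lambda>n. rho_min \<rho> (\<lambda>w. - (Y n w - Z n w))) \<longlonglongrightarrow> 0"
    by (rule sandwich[OF X]) blast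
  have YCb: "Y n \<in> Cb" for n using YZ(1) sub_Cb by blast
  have nonneg: "0 \<le> cap L \<rho> (\<lambda>w. Y n w - X w)" for n
    using extension_diff_le_cap[OF YCb X] abs_ge_zero by (rule order_trans[rotated])
  have "cap L \<rho> (\<lambda>w. Y n w - X w) \<le> rho_min \<rho> (\<lambda>w. - (Y n w - Z n w))" for n
    unfolding cap_def
  proof (rule cInf_lower)
    have "\<bar>Y n w - Z n w\<bar> = Y n w - Z n w" for w using YZ(2)[of w n] YZ(4)[of n w] by simp
    then have "rho_min \<rho> (\<lambda>w. - (Y n w - Z n w)) = c_rho \<rho> (\<lambda>w. Y n w - Z n w)" by (simp add: c_rho_def)
    then show "rho_min \<rho> (\<lambda>w. - (Y n w - Z n w)) \<in> {c_rho \<rho> V | V. V \<in> L \<and> (\<forall>w. \<bar>Y n w - X w\<bar> \<le> V w)}"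
      using YZ(2,4) diff[OF YZ(1,3)] by (auto intro!: exI[of _ "\<lambda>w. Y n w - Z n w"])
    have "0 \<le> c_rho \<rho> V" if "V \<in> L" for V
      using rho_min_antimono[OF minus[OF abs[OF that]] const[of 0]] rho_min_const[of 0] by (simp add: c_rho_def)
    then show "bdd_below {c_rho \<rho> V | V. V \<in> L \<and> (\<forall>w. \<bar>Y n w - X w\<bar> \<le> V w)}"
      by (intro bdd_belowI[of _ 0]) auto
  qed
  then have cap: "(\<lambda>n. cap L \<rho> (\<lambda>w. Y n w - X w)) \<longlonglongrightarrow> 0"
    using nonneg by (intro tendsto_sandwich[OF _ _ tendsto_const YZ(5)]) auto
  \<comment> \<open>Used both for \<sigma> and for \<open>extension\<close>, which share their
    values along the sequence.\<close>
  have lim: "(\<lambda>n. \<tau> (Y n)) \<longlonglongrightarrow> \<tau> X" and eq: "\<tau> (Y n) = \<rho> (Y n)"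
    if "cap_continuous_extension L \<rho> \<tau>" for \<tau> n
    using that X YCb cap YZ(1) unfolding cap_continuous_extension_def by blast+
  show ?thesis
    using lim[OF \<sigma>] lim[OF cap_continuous_extension_extension]
    unfolding eq[OF \<sigma>] eq[OF cap_continuous_extension_extension] by (rule LIMSEQ_unique)
qed

end

theorem theorem5p8:
  fixes L :: "('a::polish_space \<Rightarrow> real) set"
    and \<rho> :: "('a \<Rightarrow> real) \<Rightarrow> real"
  assumes "admissible_space L"
    and "convex_risk_measure L \<rho>"
    and "normalized \<rho>"
    and "uniformly_regular L \<rho>"
  shows "\<exists>\<rho>'. cap_continuous_extension L \<rho> \<rho>' \<and>
     (\<forall>\<rho>''. cap_continuous_extension L \<rho> \<rho>'' \<longrightarrow> (\<forall>X\<in>Cb. \<rho>'' X = \<rho>' X)) \<and>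
     (\<exists>Q :: nat \<Rightarrow> 'a measure.
        (\<forall>n. Q n \<in> borel_probs) \<and>
        compactin weak_top (weak_top closure_of (range Q)) \<and>
        (\<forall>X\<in>Cb. ereal (\<rho>' X) = (SUP n. ereal (\<integral>\<omega>. - X \<omega> \<partial>Q n) - penalty \<rho>' (Q n))) \<and>
        (\<forall>a :: nat \<Rightarrow> real. \<forall>P :: 'a measure.
           (\<forall>n. a n > 0) \<and> a sums 1 \<and> sets P = sets borel \<and>
           (\<forall>A\<in>sets borel. emeasure P A = (\<Sum>n. ennreal (a n) * emeasure (Q n) A)) \<longrightarrow>
           (\<forall>X\<in>Cb. (\<forall>\<omega>. X \<omega> \<le> 0) \<longrightarrow> (riskless \<rho>' X \<longleftrightarrow> (AE \<omega> in P. X \<omega> = 0)))) \<and>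
        (\<forall>X\<in>Cb. \<exists>QX \<in> weak_top closure_of (range Q).
           ereal (\<rho>' X) = ereal (\<integral>\<omega>. - X \<omega> \<partial>QX) - penalty \<rho>' QX))"
proof -
  interpret admissible_risk_measure L \<rho>
    using admissible_imp_function_lattice[OF assms(1)] assms
    by (simp add: admissible_risk_measure_def admissible_risk_measure_axioms_def
        regular_risk_measure_def regular_risk_measure_axioms_def)
  obtain Q :: "nat \<Rightarrow> 'a measure" where Q: "\<And>n. Q n \<in> ext.dominated_probs"
    "\<And>n. \<bar>penalty extension (Q n)\<bar> \<noteq> \<infinity>"
    "\<And>X. X \<in> Cb \<Longrightarrow> ereal (extension X) = (SUP n. ereal (\<integral>w. - X w \<partial>Q n) - penalty extension (Q n))"
    by (rule ext.countable_representation) blast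
  have QB: "Q n \<in> borel_probs" for n using Q(1) by (simp add: ext.dominated_probs_def)
  have riskless: "riskless extension X \<longleftrightarrow> (AE w in P. X w = 0)"
    if a: "\<forall>n. a n > 0" and P: "sets P = sets borel"
      "\<forall>A\<in>sets borel. emeasure P A = (\<Sum>n. ennreal (a n) * emeasure (Q n) A)"
      and X: "X \<in> Cb" "\<forall>w. X w \<le> 0"
    for a :: "nat \<Rightarrow> real" and P :: "'a measure" and X
  proof -
    have "(AE w in P. X w = 0) \<longleftrightarrow> (\<forall>n. AE w in Q n. X w = 0)"
    proof (rule AE_countable_mixture[where a=a])
      have "open {w. X w \<noteq> 0}" using Cb_continuous[OF X(1)] by (intro open_Collect_neq) auto
      then show "{w. X w \<noteq> 0} \<in> sets borel" by simp
    qed (use QB a P in \<open>auto simp: borel_probs_def\<close>)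
    also have "\<dots> \<longleftrightarrow> (\<forall>n. (\<integral>w. X w \<partial>Q n) = 0)"
    proof -
      have "(AE w in Q n. X w = 0) \<longleftrightarrow> (\<integral>w. - X w \<partial>Q n) = 0" for n
        using integral_nonneg_eq_0_iff_AE[of "Q n" "\<lambda>w. - X w"] X Cb_integrable[OF QB X(1)] by simp
      then show ?thesis by simp
    qed
    also have "\<dots> \<longleftrightarrow> riskless extension X"
      using ext.riskless_iff[OF Q(2,3)] X by simp
    finally show ?thesis by simp
  qed
  show ?thesis
  proof (intro exI[of _ extension] conjI exI[of _ Q])
    show "\<forall>a P. (\<forall>n. a n > 0) \<and> a sums 1 \<and> sets P = sets borel \<and>
        (\<forall>A\<in>sets borel. emeasure P A = (\<Sum>n. ennreal (a n) * emeasure (Q n) A)) \<longrightarrow>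
        (\<forall>X\<in>Cb. (\<forall>w. X w \<le> 0) \<longrightarrow> (riskless extension X \<longleftrightarrow> (AE w in P. X w = 0)))"
      by (intro allI impI ballI riskless) auto
  qed (use cap_continuous_extension_extension extension_unique QB Q(3) ext.closure_attains[OF Q] in blast)+
qed

end
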